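(* Let $X$ be a Markov process on a finite set $\Omega_0$ with intensity matrix $\lambda$, let $\{\Gamma_k,k\in K\}$ be a finite collection of subsets of $\Omega_0$, and let $\tau_k=\inf\{u\in(0,\infty):X_u\in\Gamma_k\}$. Let $s_1,s_2$ be disjoint subpartitions of $K$ and let $t\in\mathbb{R}_+^{|s_1|}$ with $t_1<t_2<\cdots<t_{|s_1|}$ (if $|s_1|=0$, set $t=0$ by convention). Suppose $\Omega_0\setminus S(s_1\cup s_2)$ is not empty and that $\alpha$ is an initial distribution on $\Omega_0$ (a row vector) that puts all of its mass on this set. Then $$P_\alpha(\mathcal{T}(s_1,s_2,t))=\alpha\,\mathbf{p}(s_1,s_2,t),$$ where the event $\mathcal{T}(s_1,s_2,t)$ and the recursively defined column vector $\mathbf{p}(s_1,s_2,t)$ are as in the context.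
   Context: Process: $\Omega_0$ is a finite set and $X=(X_u)_{u\ge 0}$ is an $\Omega_0$-valued continuous time process (right-continuous, piecewise constant paths) on a measurable space $(\Omega,\mathscr{F})$ with measures $P_i$, $i\in\Omega_0$, such that $P_i(X_0=i)=1$ and under each $P_i$, $X$ is a time-homogeneous Markov process with intensity matrix $\lambda$ (with $-\lambda(i,i)=\sum_{j\ne i}\lambda(i,j)$). $P_\alpha=\sum_i\alpha(i)P_i$. Matrices: for $a,b\subset\Omega_0$, $\boldsymbol{\lambda}(a,b)$ is the $\Omega_0\times\Omega_0$ matrix with entries $\lambda(i,j)$ if $i\in a,j\in b$, and $0$ otherwise; $\boldsymbol{\lambda}(a)=\boldsymbol{\lambda}(a,a)$. $I_a$ is the $\Omega_0\times\Omega_0$ identity matrix with the rows indexed by $\Omega_0\setminus a$ set to $0$. Subpartitions: a subpartition $s=(s(1),\dots,s(|s|))$ of $K$ is an ordered (possibly empty) sequence of disjoint nonempty subsets of $K$. Two subpartitions are disjoint if the unions of their components are disjoint; then $s_1\cup s_2$ is their concatenation. $Ls=(s(2),\dots,s(|s|))$; for a vector $t$, $Lt=(t_2,\dots,t_n)$ (and $Lt$, $Lt-r$ are $0$ by convention when $t$ has dimension 1); $t-r=(t_1-r,\dots,t_n-r)$ for $r\in\mathbb{R}$. $s-s(n)$ is $s$ with the component $s(n)$ removed, and $s+A$ is $s$ with the component $A$ (disjoint from the components of $s$) appended. $S(s)=\bigcup_{n=1}^{|s|}\bigcup_{k\in s(n)}\Gamma_k$. Event: $\mathcal{T}(s_1,s_2,t)$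 is the event that (i) for each $n\le|s_1|$, the times $\tau_k$, $k\in s_1(n)$, are all equal and their common value is $>t_n$; (ii) for each $n\le |s_2|$, the times $\tau_k$, $k\in s_2(n)$, are all equal; (iii) $\tau_k\neq\tau_{k'}$ whenever $k,k'$ belong to different components of $s_1\cup s_2$. (Hitting times take values in $[0,\infty]$.) The column vector $\mathbf{p}(s_1,s_2,t)=(\mathbf{p}_i(s_1,s_2,t))_{i\in\Omega_0}$ is defined recursively. For $s_1=\emptyset$: $\mathbf{p}_i(\emptyset,s_2,0)=P_i(\mathcal{T}(\emptyset,s_2,0))$. For $s_1\ne\emptyset$, with $$T_n(s_1,s_2)=\Big[\bigcap_{k\in s_2(n)}\Gamma_k\Big]\setminus S\big((s_1\cup s_2)-s_2(n)\big),\quad T(s_1,s_2)=\bigcup_{n=1}^{|s_2|}T_n(s_1,s_2),\quad W=\Omega_0\setminus S(s_1\cup s_2),$$ $$\mathbf{p}(s_1,s_2,t)=\int_0^{t_1}e^{u\boldsymbol{\lambda}(W)}\boldsymbol{\lambda}(W,T(s_1,s_2))\left(\sum_{n=1}^{|s_2|}I_{T_n(s_1,s_2)}\,\mathbf{p}(s_1,s_2-s_2(n),t-u)\right)du+e^{t_1\boldsymbol{\lambda}(W)}\,\mathbf{p}\big(Ls_1,\,s_2+s_1(1),\,Lt-t_1\big).$$ *)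

theory Defs
  imports "HOL-Probability.Probability"
begin

text \<open>
  The finite state space is the type \<open>'s\<close> and \<open>M\<close> carries the underlying measurable space.
  Matrices indexed by states have type \<open>real^'s^'s\<close>, with \<open>Q $ i $ j\<close> the entry in row \<open>i\<close>
  and column \<open>j\<close>.
\<close>

definition natural_filtration :: "'w measure \<Rightarrow> (real \<Rightarrow> 'w \<Rightarrow> 's) \<Rightarrow> real \<Rightarrow> 'w measure" where
  "natural_filtration M X u =
     sigma (space M) {X r -` A \<inter> space M | r A. 0 \<le> r \<and> r \<le> u}"

text \<open>
  Only \<open>X u\<close> with \<open>u \<ge> 0\<close> is constrained. Piecewise constancy means finitely many jumps in each
  bounded time interval. The matrix \<open>Q\<close> is the derivative at \<open>0\<close> of the transition function.
\<close>

locale finite_markov_process =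
  fixes M :: "'w measure"
    and P :: "'s::finite \<Rightarrow> 'w measure"
    and X :: "real \<Rightarrow> 'w \<Rightarrow> 's"
    and Q :: "real^'s^'s"
  assumes prob_space_P: "\<And>i. prob_space (P i)"
    and sets_P: "\<And>i. sets (P i) = sets M"
    and measurable_X: "\<And>u. 0 \<le> u \<Longrightarrow> X u \<in> M \<rightarrow>\<^sub>M count_space UNIV"
    and right_continuous_X: "\<And>\<omega> u. \<omega> \<in> space M \<Longrightarrow> 0 \<le> u \<Longrightarrow>
          \<forall>\<^sub>F v in at_right u. X v \<omega> = X u \<omega>"
    and finitely_many_jumps: "\<And>\<omega> v. \<omega> \<in> space M \<Longrightarrow>
          finite {u \<in> {0<..v}. \<not> (\<forall>\<^sub>F r in at u. X r \<omega> = X u \<omega>)}"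
    and start: "\<And>i. measure (P i) {\<omega> \<in> space M. X 0 \<omega> = i} = 1"
    and markov: "\<And>i u h j. 0 \<le> u \<Longrightarrow> 0 \<le> h \<Longrightarrow>
          AE \<omega> in P i.
            real_cond_exp (P i) (natural_filtration M X u)
              (indicator {\<omega>' \<in> space M. X (u + h) \<omega>' = j}) \<omega>
            = measure (P (X u \<omega>)) {\<omega>' \<in> space M. X h \<omega>' = j}"
    and intensity: "\<And>i j.
          ((\<lambda>h. (measure (P i) {\<omega> \<in> space M. X h \<omega> = j} - of_bool (i = j)) / h)
             \<longlongrightarrow> Q $ i $ j) (at_right 0)"
    and intensity_row_sum: "\<And>i. - Q $ i $ i = (\<Sum>j\<in>UNIV - {i}. Q $ i $ j)"

definition mixture :: "'w measure \<Rightarrow> ('s::finite \<Rightarrow> 'w measure) \<Rightarrow> real^'s \<Rightarrow> 'w measure" where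
  "mixture M P \<alpha> =
     measure_of (space M) (sets M) (\<lambda>A. \<Sum>i\<in>UNIV. ennreal (\<alpha> $ i) * emeasure (P i) A)"

definition hitting_time :: "(real \<Rightarrow> 'w \<Rightarrow> 's) \<Rightarrow> ('k \<Rightarrow> 's set) \<Rightarrow> 'k \<Rightarrow> 'w \<Rightarrow> ereal" where
  "hitting_time X \<Gamma> k \<omega> = Inf (ereal ` {u. 0 < u \<and> X u \<omega> \<in> \<Gamma> k})"


definition subpartition :: "'k set \<Rightarrow> 'k set list \<Rightarrow> bool" where
  "subpartition K s \<longleftrightarrow>
     (\<forall>A\<in>set s. A \<noteq> {} \<and> A \<subseteq> K) \<and> disjoint_family_on (\<lambda>n. s ! n) {..<length s}"

definition remove_component :: "nat \<Rightarrow> 'k set list \<Rightarrow> 'k set list" where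
  "remove_component n s = take n s @ drop (Suc n) s"

definition hit_states :: "('k \<Rightarrow> 's set) \<Rightarrow> 'k set list \<Rightarrow> 's set" where
  "hit_states \<Gamma> s = (\<Union>n<length s. \<Union>k\<in>s ! n. \<Gamma> k)"

text \<open>
  In the following, components and time vectors are indexed from \<open>0\<close>. The time vector of an
  empty subpartition, which the convention \<open>t = 0\<close> stands for, is the empty list.
\<close>

definition hitting_event ::
  "'w measure \<Rightarrow> (real \<Rightarrow> 'w \<Rightarrow> 's) \<Rightarrow> ('k \<Rightarrow> 's set) \<Rightarrow>
   'k set list \<Rightarrow> 'k set list \<Rightarrow> real list \<Rightarrow> 'w set" where
  "hitting_event M X \<Gamma> s1 s2 t = {\<omega> \<in> space M.
     (\<forall>n<length s1.
        (\<forall>k\<in>s1 ! n. \<forall>k'\<in>s1 ! n. hitting_time X \<Gamma> k \<omega> = hitting_time X \<Gamma> k' \<omega>) \<and>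
        (\<forall>k\<in>s1 ! n. hitting_time X \<Gamma> k \<omega> > ereal (t ! n))) \<and>
     (\<forall>n<length s2.
        \<forall>k\<in>s2 ! n. \<forall>k'\<in>s2 ! n. hitting_time X \<Gamma> k \<omega> = hitting_time X \<Gamma> k' \<omega>) \<and>
     (\<forall>m<length (s1 @ s2). \<forall>n<length (s1 @ s2). m \<noteq> n \<longrightarrow>
        (\<forall>k\<in>(s1 @ s2) ! m. \<forall>k'\<in>(s1 @ s2) ! n.
           hitting_time X \<Gamma> k \<omega> \<noteq> hitting_time X \<Gamma> k' \<omega>))}"


definition block :: "real^'s^'s \<Rightarrow> 's set \<Rightarrow> 's set \<Rightarrow> real^'s^'s" where
  "block Q a b = (\<chi> i j. if i \<in> a \<and> j \<in> b then Q $ i $ j else 0)"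

definition restricted_id :: "'s set \<Rightarrow> real^'s^'s" where
  "restricted_id a = (\<chi> i j. if i = j \<and> i \<in> a then 1 else 0)"

text \<open>
  The library function \<open>exp\<close> is not available for \<open>real^'s^'s\<close>, whose multiplication \<open>*\<close> is
  componentwise.
\<close>

definition matrix_exp :: "real^'s^'s \<Rightarrow> real^'s^'s" where
  "matrix_exp A = (\<Sum>m. (1 / fact m) *\<^sub>R ((\<lambda>B. A ** B) ^^ m) (mat 1))"

definition exit_component ::
  "('k \<Rightarrow> 's set) \<Rightarrow> 'k set list \<Rightarrow> 'k set list \<Rightarrow> nat \<Rightarrow> 's set" where
  "exit_component \<Gamma> s1 s2 n =
     (\<Inter>k\<in>s2 ! n. \<Gamma> k) - hit_states \<Gamma> (s1 @ remove_component n s2)"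

definition exit_states :: "('k \<Rightarrow> 's set) \<Rightarrow> 'k set list \<Rightarrow> 'k set list \<Rightarrow> 's set" where
  "exit_states \<Gamma> s1 s2 = (\<Union>n<length s2. exit_component \<Gamma> s1 s2 n)"

function prob_vector ::
  "'w measure \<Rightarrow> ('s::finite \<Rightarrow> 'w measure) \<Rightarrow> (real \<Rightarrow> 'w \<Rightarrow> 's) \<Rightarrow> real^'s^'s \<Rightarrow>
   ('k \<Rightarrow> 's set) \<Rightarrow> 'k set list \<Rightarrow> 'k set list \<Rightarrow> real list \<Rightarrow> real^'s" where
  "prob_vector M P X Q \<Gamma> [] s2 t = (\<chi> i. measure (P i) (hitting_event M X \<Gamma> [] s2 []))"
| "prob_vector M P X Q \<Gamma> (A # s1) s2 t =
     (let t1 = hd t;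
          W = - hit_states \<Gamma> ((A # s1) @ s2)
      in (LBINT u:{0..t1}.
            (matrix_exp (u *\<^sub>R block Q W W) ** block Q W (exit_states \<Gamma> (A # s1) s2)) *v
            (\<Sum>n<length s2. restricted_id (exit_component \<Gamma> (A # s1) s2 n) *v
               prob_vector M P X Q \<Gamma> (A # s1) (remove_component n s2) (map (\<lambda>r. r - u) t)))
         + matrix_exp (t1 *\<^sub>R block Q W W) *v
             prob_vector M P X Q \<Gamma> s1 (s2 @ [A]) (map (\<lambda>r. r - t1) (tl t)))"
  by pat_completeness auto
termination
  by (relation "measures [\<lambda>(_, _, _, _, _, s1, _, _). length s1, \<lambda>(_, _, _, _, _, _, s2, _). length s2]")
     (auto simp: remove_component_def)

end

theory Submission
  imports Defs
begin

text \<open>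
  Let \<open>W\<close> be the complement of \<open>S(s\<^sub>1 \<union> s\<^sub>2)\<close> and cut \<open>[0, t\<^sub>1]\<close> into \<open>N\<close> cells of length \<open>h\<close>. A path has
  finitely many jumps, so for large \<open>N\<close> each cell contains at most one of them. Then the event
  is determined by the first grid point outside \<open>W\<close>: the state there must lie in some \<open>T\<^sub>n\<close>, and
  the path from that grid point on must satisfy the event for \<open>s\<^sub>2 - s\<^sub>2(n)\<close>; if no grid point
  is outside \<open>W\<close>, then the path from \<open>t\<^sub>1\<close> on must satisfy the event in which \<open>s\<^sub>1(1)\<close> has
  moved to \<open>s\<^sub>2\<close>. By the Markov property at the (deterministic) grid points, the probability is the limit
  of Riemann sums whose weights are the entries of \<open>(I + h C\<^sub>h)\<^sup>k\<close>, with \<open>C\<^sub>h\<close> tending to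
  \<open>\<lambda>(W)\<close>, multiplied by transition probabilities from \<open>W\<close> to \<open>T\<^sub>n\<close>. These weights converge to
  \<open>e\<^bsup>u\<lambda>(W)\<^esup>\<close>, and the remaining factor is monotone in \<open>u\<close>, hence almost everywhere
  continuous. The limit is the recursion for \<open>p\<close>; the strong Markov property is not needed.
\<close>

section \<open>Hitting times of a path\<close>

text \<open>Two jumps inside one cell could hide a visit to a target between grid points. With at
  most one jump, every state met in a cell is already met at one of its end points. How fine the
  grid must be depends on the path, so the identity of indicators holds only eventually for each
  path, and dominated convergence carries it over to probabilities. The claim is proved only for
  starting states outside \<open>hit_states \<Gamma> (s1 @ s2)\<close>, where every \<tau>_k is
  positive. This class is stable under the recursion: a state of T_n avoids the targets of all
  components but the removed one, and for i in W the row i of the exponential has no entry outside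
  W. The Markov property is assumed for one future time, but hitting events depend on a whole path.
  It is therefore extended to the product sigma-algebra, in which hitting times appear as infima
  over rational times. The remaining factor is monotone because a larger u lowers all thresholds r -
  u. The case t1 = 0 admits no grid and is treated directly. The integral in the recursion is one of
  vectors, so all its coordinates must be shown integrable, including those outside W.\<close>

definition right_continuous_path :: "(real \<Rightarrow> 's) \<Rightarrow> bool" where
  "right_continuous_path x \<longleftrightarrow> (\<forall>u\<ge>0. \<forall>\<^sub>F v in at_right u. x v = x u)"

text \<open>\<open>hitting_time\<close> for one path and one target set, so that restarting the path
  at a later time is a mere substitution for \<open>x\<close>.\<close>

definition hit :: "(real \<Rightarrow> 's) \<Rightarrow> 's set \<Rightarrow> ereal" where
  "hit x B = Inf (ereal ` {u. 0 < u \<and> x u \<in> B})"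

lemma right_continuous_path_shift:
  assumes "right_continuous_path x" "0 \<le> u"
  shows "right_continuous_path (\<lambda>r. x (u + r))"
  unfolding right_continuous_path_def
proof (intro allI impI)
  fix v :: real assume "0 \<le> v"
  then have "\<forall>\<^sub>F w in at_right (u + v). x w = x (u + v)"
    using assms by (auto simp: right_continuous_path_def)
  then obtain b where b: "b > u + v" "\<And>w. u + v < w \<Longrightarrow> w < b \<Longrightarrow> x w = x (u + v)"
    by (auto simp: eventually_at_right_field)
  then show "\<forall>\<^sub>F w in at_right v. x (u + w) = x (u + v)"
    unfolding eventually_at_right_field by (intro exI[of _ "b - u"]) auto
qed

lemma right_continuous_pathD:
  assumes "right_continuous_path x" "0 \<le> u"
  obtains b where "u < b" "\<And>v. u \<le> v \<Longrightarrow> v < b \<Longrightarrow> x v = x u"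
proof -
  have "\<forall>\<^sub>F v in at_right u. x v = x u"
    using assms by (auto simp: right_continuous_path_def)
  then obtain b where "b > u" "\<And>w. u < w \<Longrightarrow> w < b \<Longrightarrow> x w = x u"
    by (auto simp: eventually_at_right_field)
  then show thesis using that by (metis order_le_less)
qed

text \<open>Time 0 never counts in \<open>hit\<close>. The shifted path would overlook a visit at
  time \<open>u\<close>, which is why \<open>u\<close> itself is among the excluded times.\<close>

lemma hit_shift:
  assumes "0 \<le> u" and "\<And>v. 0 < v \<Longrightarrow> v \<le> u \<Longrightarrow> x v \<notin> B"
  shows "hit x B = ereal u + hit (\<lambda>r. x (u + r)) B"
proof -
  let ?V = "{r. 0 < r \<and> x (u + r) \<in> B}"
  have "{v. 0 < v \<and> x v \<in> B} = (+) u ` ?V"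
  proof (intro equalityI subsetI)
    fix v assume "v \<in> {v. 0 < v \<and> x v \<in> B}"
    then have "v - u \<in> ?V" using assms(2)[of v] by force
    then show "v \<in> (+) u ` ?V" by (intro image_eqI[of _ _ "v - u"]) auto
  qed (use \<open>0 \<le> u\<close> in auto)
  then have "hit x B = (INF r\<in>?V. ereal u + ereal r)"
    unfolding hit_def by (simp add: image_image)
  also have "\<dots> = ereal u + (INF r\<in>?V. ereal r)"
  proof (cases "?V = {}")
    \<comment> \<open>No visit after \<open>u\<close>: both infima run over the empty set and are
      infinite.\<close>
    case True
    then show ?thesis unfolding True by (simp add: top_ereal_def)
  next
    case False
    have "(INF r\<in>?V. ereal u + ereal r) = ereal u + (INF r\<in>?V. ereal r)"
      by (rule INF_ereal_add_right) (use False in auto)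
    then show ?thesis by simp
  qed
  finally show ?thesis by (simp add: hit_def)
qed

lemma hit_at:
  assumes "0 < u" "x u \<in> B" and "\<And>v. 0 < v \<Longrightarrow> v < u \<Longrightarrow> x v \<notin> B"
  shows "hit x B = ereal u"
  unfolding hit_def
proof (rule Inf_eqI)
  fix y assume "y \<in> ereal ` {u. 0 < u \<and> x u \<in> B}"
  then show "ereal u \<le> y" using assms(3) by force
qed (use assms in auto)

text \<open>The path keeps its initial state for a positive time. Applied to a path restarted at
  \<open>b\<close>, this turns "no visit up to \<open>b\<close>" into a hitting time strictly
  greater than \<open>b\<close>, as thresholds and distinctness require.\<close>

lemma hit_pos:
  assumes "right_continuous_path x" "x 0 \<notin> B"
  shows "0 < hit x B"
proof -
  obtain b where b: "0 < b" "\<And>v. 0 \<le> v \<Longrightarrow> v < b \<Longrightarrow> x v = x 0"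
    using right_continuous_pathD[OF assms(1), of 0] by auto
  have "ereal b \<le> hit x B"
    unfolding hit_def
  proof (rule Inf_greatest)
    fix y assume "y \<in> ereal ` {u. 0 < u \<and> x u \<in> B}"
    then obtain v where "y = ereal v" "0 < v" "x v \<in> B" by auto
    then show "ereal b \<le> y" using b(2)[of v] assms(2) by (cases "v < b") auto
  qed
  with b(1) show ?thesis by (metis ereal_less(2) less_le_trans)
qed

text \<open>A right-continuous path that visits \<open>B\<close> at time \<open>u\<close> stays
  there for an interval, which contains rationals arbitrarily close to \<open>u\<close>. The
  countable infimum gives measurability.\<close>

lemma hit_eq_INF_rat:
  assumes "right_continuous_path x"
  shows "hit x B = (INF q\<in>\<rat> \<inter> {0<..}. if x q \<in> B then ereal q else \<infinity>)"
proof (rule antisym)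
  show "hit x B \<le> (INF q\<in>\<rat> \<inter> {0<..}. if x q \<in> B then ereal q else \<infinity>)"
    unfolding hit_def by (intro INF_greatest) (auto intro!: Inf_lower)
  show "(INF q\<in>\<rat> \<inter> {0<..}. if x q \<in> B then ereal q else \<infinity>) \<le> hit x B" (is "?I \<le> _")
    unfolding hit_def
  proof (rule Inf_greatest)
    fix y assume "y \<in> ereal ` {u. 0 < u \<and> x u \<in> B}"
    then obtain u where u: "y = ereal u" "0 < u" "x u \<in> B" by auto
    obtain b where b: "u < b" "\<And>v. u \<le> v \<Longrightarrow> v < b \<Longrightarrow> x v = x u"
      using right_continuous_pathD[OF assms, of u] u(2) by auto
    show "?I \<le> y"
    proof (rule ereal_le_epsilon2)
      fix e :: real assume "0 < e"
      then obtain q where q: "q \<in> \<rat>" "u < q" "q < min b (u + e)"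
        using Rats_dense_in_real[of u "min b (u + e)"] b(1) by auto
      then have "?I \<le> (if x q \<in> B then ereal q else \<infinity>)"
        using u(2) by (intro INF_lower) auto
      also have "\<dots> = ereal q" using b(2)[of q] q u by auto
      also have "\<dots> \<le> y + ereal e" using q u by auto
      finally show "?I \<le> y + ereal e" .
    qed
  qed
qed

text \<open>The condition on the hitting times; for thresholds matching \<open>s1\<close> in length it is equivalent to
  the one in \<open>hitting_event\<close>, without indices.\<close>

definition compatible ::
  "'k set list \<Rightarrow> 'k set list \<Rightarrow> real list \<Rightarrow> ('k \<Rightarrow> ereal) \<Rightarrow> bool" where
  "compatible s1 s2 t \<tau> \<longleftrightarrow>
     list_all2 (\<lambda>A r. \<forall>k\<in>A. ereal r < \<tau> k) s1 t \<and>
     (\<forall>A\<in>set (s1 @ s2). \<forall>k\<in>A. \<forall>k'\<in>A. \<tau> k = \<tau> k') \<and>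
     sorted_wrt (\<lambda>A B. \<forall>k\<in>A. \<forall>k'\<in>B. \<tau> k \<noteq> \<tau> k') (s1 @ s2)"

text \<open>Distinctness is symmetric in the two components, so the pairs of positions m < n tested
  by \<open>sorted_wrt\<close> suffice for all m \<noteq> n.\<close>

lemma compatible_iff_nth:
  fixes \<tau> :: "'k \<Rightarrow> ereal"
  assumes "length t = length s1"
  shows "compatible s1 s2 t \<tau> \<longleftrightarrow>
    (\<forall>n<length s1. (\<forall>k\<in>s1 ! n. \<forall>k'\<in>s1 ! n. \<tau> k = \<tau> k') \<and> (\<forall>k\<in>s1 ! n. \<tau> k > ereal (t ! n))) \<and>
    (\<forall>n<length s2. \<forall>k\<in>s2 ! n. \<forall>k'\<in>s2 ! n. \<tau> k = \<tau> k') \<and>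
    (\<forall>m<length (s1 @ s2). \<forall>n<length (s1 @ s2). m \<noteq> n \<longrightarrow>
        (\<forall>k\<in>(s1 @ s2) ! m. \<forall>k'\<in>(s1 @ s2) ! n. \<tau> k \<noteq> \<tau> k'))"
proof -
  have "(\<forall>m<length s. \<forall>n<length s. m \<noteq> n \<longrightarrow> (\<forall>k\<in>s ! m. \<forall>k'\<in>s ! n. \<tau> k \<noteq> \<tau> k')) \<longleftrightarrow>
    sorted_wrt (\<lambda>A B. \<forall>k\<in>A. \<forall>k'\<in>B. \<tau> k \<noteq> \<tau> k') s" for s
    unfolding sorted_wrt_iff_nth_less
  proof (intro iffI allI impI ballI)
    fix m n k k'
    assume *: "\<forall>i j. i < j \<longrightarrow> j < length s \<longrightarrow> (\<forall>k\<in>s ! i. \<forall>k'\<in>s ! j. \<tau> k \<noteq> \<tau> k')"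
      and "m < length s" "n < length s" "m \<noteq> n" "k \<in> s ! m" "k' \<in> s ! n"
    then show "\<tau> k \<noteq> \<tau> k'"
      using *[rule_format, of m n k k'] *[rule_format, of n m k' k] by (cases "m < n") auto
  next
    fix i j k k'
    assume *: "\<forall>m<length s. \<forall>n<length s. m \<noteq> n \<longrightarrow> (\<forall>k\<in>s ! m. \<forall>k'\<in>s ! n. \<tau> k \<noteq> \<tau> k')"
      and "i < j" "j < length s" "k \<in> s ! i" "k' \<in> s ! j"
    then show "\<tau> k \<noteq> \<tau> k'"
      using *[rule_format, of i j k k'] by simp
  qed
  moreover have "list_all2 (\<lambda>A r. \<forall>k\<in>A. ereal r < \<tau> k) s1 t \<longleftrightarrow>
      (\<forall>n<length s1. \<forall>k\<in>s1 ! n. ereal (t ! n) < \<tau> k)"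
    using assms by (simp add: list_all2_conv_all_nth)
  moreover have "(\<forall>A\<in>set (s1 @ s2). P A) \<longleftrightarrow>
      (\<forall>n<length s1. P (s1 ! n)) \<and> (\<forall>n<length s2. P (s2 ! n))" for P
    by (simp add: ball_Un all_set_conv_all_nth)
  ultimately show ?thesis
    unfolding compatible_def by (simp only: all_conj_distrib imp_conjR conj_ac)
qed

lemma hitting_event_eq_compatible:
  assumes "length t = length s1"
  shows "hitting_event M Y \<Gamma> s1 s2 t =
    {\<omega> \<in> space M. compatible s1 s2 t (\<lambda>k. hit (\<lambda>r. Y r \<omega>) (\<Gamma> k))}"
  unfolding compatible_iff_nth[OF assms] hitting_event_def hitting_time_def hit_def ..

text \<open>A component of \<open>s2\<close> carries no threshold. \<open>B\<close> adds only its
  internal equalities and its distinctness from the rest, which are the two hypotheses.\<close>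

lemma compatible_remove:
  assumes dist: "\<And>k k'. k \<in> B \<Longrightarrow> k' \<in> \<Union>(set (s1 @ as @ bs)) \<Longrightarrow> \<tau> k \<noteq> \<tau> k'"
    and eq: "\<And>k k'. k \<in> B \<Longrightarrow> k' \<in> B \<Longrightarrow> \<tau> k = \<tau> k'"
  shows "compatible s1 (as @ B # bs) t \<tau> \<longleftrightarrow> compatible s1 (as @ bs) t \<tau>"
proof -
  define D where "D = (\<lambda>A B. \<forall>k\<in>A. \<forall>k'\<in>B. \<tau> k \<noteq> \<tau> k')"
  have D: "D B C \<and> D C B" if "C \<in> set (s1 @ as @ bs)" for C
    using dist that unfolding D_def by (metis UnionI)
  have "sorted_wrt D (s1 @ as @ B # bs) \<longleftrightarrow> sorted_wrt D (s1 @ as @ bs)"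
    using D by (auto simp: sorted_wrt_append)
  moreover define E where "E = (\<lambda>A. \<forall>k\<in>A. \<forall>k'\<in>A. \<tau> k = \<tau> k')"
  moreover have "E B" using eq unfolding E_def by blast
  ultimately show ?thesis unfolding compatible_def D_def[symmetric] E_def[symmetric] by auto
qed

text \<open>Adding a finite constant is injective and order preserving on \<open>ereal\<close>,
  infinity included, and the thresholds move along.\<close>

lemma compatible_shift:
  assumes eq: "\<And>k. k \<in> \<Union>(set (s1 @ s2)) \<Longrightarrow> \<tau> k = ereal u + \<tau>' k"
  shows "compatible s1 s2 t \<tau> \<longleftrightarrow> compatible s1 s2 (map (\<lambda>r. r - u) t) \<tau>'"
proof -
  let ?D = "\<lambda>A B. \<forall>k\<in>A. \<forall>k'\<in>B. \<tau> k \<noteq> \<tau> k'"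
  let ?D' = "\<lambda>A B. \<forall>k\<in>A. \<forall>k'\<in>B. \<tau>' k \<noteq> \<tau>' k'"
  have "list_all2 (\<lambda>A r. \<forall>k\<in>A. ereal r < \<tau> k) s1 t \<longleftrightarrow>
        list_all2 (\<lambda>A r. \<forall>k\<in>A. ereal r < \<tau>' k) s1 (map (\<lambda>r. r - u) t)"
    unfolding list_all2_map2
  proof (intro iffI; erule list.rel_mono_strong)
    fix A r assume "A \<in> set s1"
    have "ereal r < ereal u + z \<longleftrightarrow> ereal (r - u) < z" for z
      by (cases z) auto
    moreover have "\<tau> k = ereal u + \<tau>' k" if "k \<in> A" for k
      using eq \<open>A \<in> set s1\<close> that by auto
    ultimately show "\<forall>k\<in>A. ereal r < \<tau> k \<Longrightarrow> \<forall>k\<in>A. ereal (r - u) < \<tau>' k"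
      "\<forall>k\<in>A. ereal (r - u) < \<tau>' k \<Longrightarrow> \<forall>k\<in>A. ereal r < \<tau> k"
      by auto
  qed
  moreover have "sorted_wrt ?D (s1 @ s2) \<longleftrightarrow>
      sorted_wrt ?D' (s1 @ s2)"
  proof -
    have "\<tau> k = \<tau> k' \<longleftrightarrow> \<tau>' k = \<tau>' k'" if "A \<in> set (s1 @ s2)" "B \<in> set (s1 @ s2)" "k \<in> A" "k' \<in> B" for A B k k'
    proof -
      have "\<tau> k = ereal u + \<tau>' k" "\<tau> k' = ereal u + \<tau>' k'"
        using eq that by blast+
      then show ?thesis by (simp add: ereal_add_cancel_left)
    qed
    then have "?D A B \<longleftrightarrow> ?D' A B" if "A \<in> set (s1 @ s2)" "B \<in> set (s1 @ s2)" for A B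
      using that by (intro ball_cong refl) metis
    then show ?thesis
      using sorted_wrt_mono_rel[of "s1 @ s2" ?D ?D'] sorted_wrt_mono_rel[of "s1 @ s2" ?D' ?D] by blast
  qed
  moreover have "(\<forall>A\<in>set (s1 @ s2). \<forall>k\<in>A. \<forall>k'\<in>A. \<tau> k = \<tau> k') \<longleftrightarrow>
      (\<forall>A\<in>set (s1 @ s2). \<forall>k\<in>A. \<forall>k'\<in>A. \<tau>' k = \<tau>' k')"
  proof (intro ball_cong refl)
    fix A k k' assume "A \<in> set (s1 @ s2)" "k \<in> A" "k' \<in> A"
    then have "\<tau> k = ereal u + \<tau>' k" "\<tau> k' = ereal u + \<tau>' k'"
      using eq by blast+
    then show "\<tau> k = \<tau> k' \<longleftrightarrow> \<tau>' k = \<tau>' k'" by (simp add: ereal_add_cancel_left)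
  qed
  ultimately show ?thesis unfolding compatible_def by blast
qed

text \<open>Components of \<open>s1\<close> and of \<open>s2\<close> differ only in having a
  threshold. Once it is exceeded, \<open>A\<close> is an ordinary component of \<open>s2\<close>,
  and the order of components is immaterial.\<close>

lemma compatible_pass_threshold:
  assumes "\<And>k. k \<in> A \<Longrightarrow> ereal r < \<tau> k"
  shows "compatible (A # s1) s2 (r # t) \<tau> \<longleftrightarrow> compatible s1 (s2 @ [A]) t \<tau>"
proof -
  define D where "D = (\<lambda>A B. \<forall>k\<in>A. \<forall>k'\<in>B. \<tau> k \<noteq> \<tau> k')"
  have D: "D B C \<longleftrightarrow> D C B" for B C
    unfolding D_def by metis
  have "sorted_wrt D ((A # s1) @ s2) \<longleftrightarrow> sorted_wrt D (s1 @ s2 @ [A])"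
    using D by (auto simp: sorted_wrt_append)
  then show ?thesis
    using assms unfolding compatible_def D_def[symmetric] by (simp add: Un_commute insert_commute)
qed

text \<open>Source of the monotonicity in u of the factor under the integral.\<close>

lemma compatible_lower_thresholds:
  assumes "compatible s1 s2 t \<tau>" "list_all2 (\<lambda>r r'. r' \<le> r) t t'"
  shows "compatible s1 s2 t' \<tau>"
proof -
  have "list_all2 (\<lambda>A r. \<forall>k\<in>A. ereal r < \<tau> k) s1 t'"
  proof (rule list_all2_trans[OF _ _ assms(2)])
    show "list_all2 (\<lambda>A r. \<forall>k\<in>A. ereal r < \<tau> k) s1 t"
      using assms(1) unfolding compatible_def by blast
    show "\<forall>k\<in>A. ereal r' < \<tau> k" if "\<forall>k\<in>A. ereal r < \<tau> k" "r' \<le> r" for A r r'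
      using that by (meson ereal_less_eq(3) order_le_less_trans)
  qed
  then show ?thesis
    using assms(1) unfolding compatible_def by blast
qed

section \<open>Piecewise constant paths and their first exit from a set\<close>

lemma hit_states_Union: "hit_states \<Gamma> s = (\<Union>k\<in>\<Union>(set s). \<Gamma> k)"
  by (fastforce simp: hit_states_def set_conv_nth)

text \<open>A locally constant function on a connected set is constant. Near the left end
  \<open>a\<close> only times after \<open>a\<close> belong to \<open>S\<close>, so right continuity
  suffices there and \<open>a\<close> itself may be a jump time.\<close>

lemma right_continuous_path_constant:
  fixes x :: "real \<Rightarrow> 's"
  assumes "right_continuous_path x" "0 \<le> a" "connected S" "a \<in> S" "S \<subseteq> {a..}"
    and loc: "\<And>w. w \<in> S \<Longrightarrow> w \<noteq> a \<Longrightarrow> \<forall>\<^sub>F r in at w. x r = x w"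
    and "b \<in> S"
  shows "x b = x a"
proof -
  have "\<forall>w\<in>S. \<forall>\<^sub>F r in at w within S. x w = x r"
  proof
    fix w assume "w \<in> S"
    show "\<forall>\<^sub>F r in at w within S. x w = x r"
    proof (cases "w = a")
      case True
      have "\<forall>\<^sub>F r in at_right a. x r = x a"
        using assms by (auto simp: right_continuous_path_def)
      then show ?thesis
        unfolding True eventually_at_filter by eventually_elim (use \<open>S \<subseteq> {a..}\<close> in fastforce)
    next
      case False
      then show ?thesis
        using loc[OF \<open>w \<in> S\<close>] unfolding eventually_at_filter by (auto elim: eventually_mono)
    qed
  qed
  from connected_local_const[OF \<open>connected S\<close> \<open>b \<in> S\<close> \<open>a \<in> S\<close> this] show ?thesis .
qed

lemma single_jump_on_short_intervals:
  fixes x :: "real \<Rightarrow> 's"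
  assumes rc: "right_continuous_path x"
    and fin: "finite {u \<in> {0<..v}. \<not> (\<forall>\<^sub>F r in at u. x r = x u)}" (is "finite ?D")
  obtains \<delta> where "0 < \<delta>"
    and "\<And>a b. 0 \<le> a \<Longrightarrow> a < b \<Longrightarrow> b \<le> v \<Longrightarrow> b - a < \<delta> \<Longrightarrow>
      \<exists>\<sigma>. a < \<sigma> \<and> \<sigma> \<le> b \<and> (\<forall>w. a \<le> w \<and> w < \<sigma> \<longrightarrow> x w = x a) \<and> (\<forall>w. \<sigma> \<le> w \<and> w \<le> b \<longrightarrow> x w = x b)"
proof -
  \<comment> \<open>The least distance between two different jump times, capped by 1. Removing 0
    discards the pairs of equal times; the 1 keeps the set nonempty.\<close>
  define \<delta> where "\<delta> = Min (insert 1 ((\<lambda>(d, d'). \<bar>d - d'\<bar>) ` (?D \<times> ?D) - {0}))"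
  have fin': "finite (insert 1 ((\<lambda>(d, d'). \<bar>d - d'\<bar>) ` (?D \<times> ?D) - {0}))"
    by (intro finite.insertI finite_Diff finite_imageI finite_cartesian_product fin)
  have "0 < \<delta>"
    unfolding \<delta>_def using fin' by (subst Min_gr_iff) auto
  moreover have "\<exists>\<sigma>. a < \<sigma> \<and> \<sigma> \<le> b \<and> (\<forall>w. a \<le> w \<and> w < \<sigma> \<longrightarrow> x w = x a) \<and>
      (\<forall>w. \<sigma> \<le> w \<and> w \<le> b \<longrightarrow> x w = x b)"
    if ab: "0 \<le> a" "a < b" "b \<le> v" "b - a < \<delta>" for a b
  proof -
    have sep: "d = d'" if "d \<in> ?D" "d' \<in> ?D" "a < d" "d \<le> b" "a < d'" "d' \<le> b" for d d'
    proof (rule ccontr)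
      assume "d \<noteq> d'"
      then have "\<delta> \<le> \<bar>d - d'\<bar>"
        unfolding \<delta>_def using that fin' by (intro Min_le) auto
      then show False using ab that by (auto simp: abs_if split: if_splits)
    qed
    \<comment> \<open>If the cell contains no jump, its right end \<open>b\<close> serves as
      \<sigma>.\<close>
    obtain \<sigma> where "a < \<sigma> \<and> \<sigma> \<le> b \<and> (\<forall>d\<in>?D. a < d \<longrightarrow> d \<le> b \<longrightarrow> d = \<sigma>)"
    proof (cases "\<exists>d\<in>?D. a < d \<and> d \<le> b")
      case True
      then show thesis using sep that by blast
    next
      case False
      then show thesis using that[of b] ab by blast
    qed
    then have \<sigma>: "a < \<sigma>" "\<sigma> \<le> b" and uniq: "\<And>d. d \<in> ?D \<Longrightarrow> a < d \<Longrightarrow> d \<le> b \<Longrightarrow> d = \<sigma>"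
      by blast+
    have loc: "\<forall>\<^sub>F r in at w. x r = x w" if "a < w" "w \<le> b" "w \<noteq> \<sigma>" for w
    proof -
      have "w \<notin> ?D" using uniq[of w] that by blast
      then show ?thesis using ab that by simp
    qed
    have "x w = x a" if "a \<le> w" "w < \<sigma>" for w
      by (rule right_continuous_path_constant[OF rc ab(1), of "{a..<\<sigma>}"]) (use that \<sigma> loc in auto)
    moreover have "x w = x \<sigma>" if "\<sigma> \<le> w" "w \<le> b" for w
      by (rule right_continuous_path_constant[OF rc, of \<sigma> "{\<sigma>..b}"]) (use that \<sigma> loc ab in auto)
    ultimately show ?thesis using \<sigma> by (metis order_refl)
  qed
  ultimately show thesis by (rule that)
qed

lemma set_remove_component:
  assumes "n < length s"
  shows "set s = insert (s ! n) (set (remove_component n s))"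
  using arg_cong[OF id_take_nth_drop[OF assms], of set] by (simp add: remove_component_def)

lemma nth_mem_remove_component:
  assumes "m < length s" "m \<noteq> n"
  shows "s ! m \<in> set (remove_component n s)"
proof (cases "m < n")
  case True
  then have "take n s ! m = s ! m" "m < length (take n s)" using assms by auto
  then show ?thesis unfolding remove_component_def by (metis UnCI nth_mem set_append)
next
  case False
  then have "drop (Suc n) s ! (m - Suc n) = s ! m" "m - Suc n < length (drop (Suc n) s)"
    using assms by auto
  then show ?thesis unfolding remove_component_def by (metis UnCI nth_mem set_append)
qed

text \<open>A state of T_m lies in every \<Gamma>_k with k in the m-th component, whereas a state of
  T_n lies in none of them. Both cannot hold, since that component is nonempty.\<close>

lemma exit_component_unique:
  assumes "{} \<notin> set s2" "m < length s2" "n < length s2"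
    and "l \<in> exit_component \<Gamma> s1 s2 m" "l \<in> exit_component \<Gamma> s1 s2 n"
  shows "m = n"
proof (rule ccontr)
  assume "m \<noteq> n"
  then have "s2 ! m \<in> set (remove_component n s2)" "s2 ! m \<noteq> {}"
    using assms nth_mem_remove_component[of m s2 n] nth_mem by metis+
  then show False
    using assms(4,5) unfolding exit_component_def hit_states_Union by auto
qed

text \<open>At \<sigma> the path jumps from outside all targets straight into \<open>l\<close> and
  rests there up to \<open>b\<close>. Among the relevant k, exactly those with \<open>l\<close> in
  \<Gamma>_k have \<tau>_k = \<sigma>, and all others have \<tau>_k > \<open>b\<close>. The event
  therefore forces the k hit at \<sigma> to form one whole component. It cannot be one of
  \<open>s1\<close>, since their thresholds are at least \<open>b\<close> \<ge> \<sigma>. Hence it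
  is the n-th of \<open>s2\<close>, and \<open>l\<close> lies in T_n. That component imposes nothing
  further, and the others can be judged from \<open>b\<close> on.\<close>

lemma compatible_exit:
  assumes rc: "right_continuous_path x"
    and \<sigma>: "0 < \<sigma>" "\<sigma> \<le> b" "\<forall>r\<in>set t. b \<le> r"
    and before: "\<And>w. 0 \<le> w \<Longrightarrow> w < \<sigma> \<Longrightarrow> x w \<notin> hit_states \<Gamma> (s1 @ s2)"
    and after: "\<And>w. \<sigma> \<le> w \<Longrightarrow> w \<le> b \<Longrightarrow> x w = l"
    and l: "l \<in> hit_states \<Gamma> (s1 @ s2)"
    and ne: "{} \<notin> set s2"
  shows "compatible s1 s2 t (\<lambda>k. hit x (\<Gamma> k)) \<longleftrightarrow>
    (\<exists>n<length s2. l \<in> exit_component \<Gamma> s1 s2 n \<and>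
       compatible s1 (remove_component n s2) (map (\<lambda>r. r - b) t) (\<lambda>k. hit (\<lambda>r. x (b + r)) (\<Gamma> k)))"
    (is "?L \<longleftrightarrow> (\<exists>n<_. _ \<and> ?R n)")
proof -
  let ?\<tau> = "\<lambda>k. hit x (\<Gamma> k)" and ?\<tau>' = "\<lambda>k. hit (\<lambda>r. x (b + r)) (\<Gamma> k)"
  have hit: "?\<tau> k = ereal \<sigma>" if "k \<in> \<Union>(set (s1 @ s2))" "l \<in> \<Gamma> k" for k
  proof (rule hit_at)
    show "x \<sigma> \<in> \<Gamma> k" using after[of \<sigma>] \<sigma> that by simp
    show "x v \<notin> \<Gamma> k" if "0 < v" "v < \<sigma>" for v
      using before[of v] that \<open>k \<in> _\<close> unfolding hit_states_Union by auto
  qed fact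
  have shift: "?\<tau> k = ereal b + ?\<tau>' k" and later: "ereal \<sigma> < ?\<tau> k"
    if "k \<in> \<Union>(set (s1 @ s2))" "l \<notin> \<Gamma> k" for k
  proof -
    have "x v \<notin> \<Gamma> k" if "0 < v" "v \<le> b" for v
      using before[of v] after[of v] that \<open>k \<in> _\<close> \<open>l \<notin> _\<close> unfolding hit_states_Union
      by (cases "v < \<sigma>") auto
    then show eq: "?\<tau> k = ereal b + ?\<tau>' k"
      using \<sigma> by (intro hit_shift) auto
    have "0 < ?\<tau>' k"
      using rc \<sigma> after[of b] that by (intro hit_pos right_continuous_path_shift) auto
    then have "ereal b < ereal b + ?\<tau>' k"
      by (cases "?\<tau>' k") auto
    with \<sigma> show "ereal \<sigma> < ?\<tau> k"
      unfolding eq by (metis ereal_less_eq(3) order_le_less_trans)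
  qed
  have equiv: "?L \<longleftrightarrow> ?R n" if n: "n < length s2" and "l \<in> exit_component \<Gamma> s1 s2 n" for n
  proof -
    have s2: "s2 = take n s2 @ s2 ! n # drop (Suc n) s2"
      using n by (rule id_take_nth_drop)
    have B: "l \<in> \<Gamma> k" if "k \<in> s2 ! n" for k
      using that \<open>l \<in> exit_component _ _ _ _\<close> by (auto simp: exit_component_def)
    have other: "l \<notin> \<Gamma> k" if "k \<in> \<Union>(set (s1 @ remove_component n s2))" for k
      using that \<open>l \<in> exit_component _ _ _ _\<close> unfolding exit_component_def hit_states_Union by auto
    have sub: "set (s1 @ s2) = insert (s2 ! n) (set (s1 @ remove_component n s2))"
      using set_remove_component[OF n] by auto
    have "?L \<longleftrightarrow> compatible s1 (take n s2 @ s2 ! n # drop (Suc n) s2) t ?\<tau>"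
      using s2 by simp
    also have "\<dots> \<longleftrightarrow> compatible s1 (remove_component n s2) t ?\<tau>"
      unfolding remove_component_def
    proof (rule compatible_remove)
      fix k k' assume k: "k \<in> s2 ! n" "k' \<in> \<Union>(set (s1 @ take n s2 @ drop (Suc n) s2))"
      then have "k \<in> \<Union>(set (s1 @ s2))" "k' \<in> \<Union>(set (s1 @ s2))" "l \<in> \<Gamma> k" "l \<notin> \<Gamma> k'"
        unfolding sub using B other by (auto simp: remove_component_def)
      then have "?\<tau> k = ereal \<sigma>" "ereal \<sigma> < ?\<tau> k'" using hit later by blast+
      then show "?\<tau> k \<noteq> ?\<tau> k'" by force
    next
      fix k k' assume k: "k \<in> s2 ! n" "k' \<in> s2 ! n"
      then have "?\<tau> k = ereal \<sigma>" "?\<tau> k' = ereal \<sigma>" using hit B unfolding sub by blast+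
      then show "?\<tau> k = ?\<tau> k'" by simp
    qed
    also have "\<dots> \<longleftrightarrow> ?R n"
    proof (rule compatible_shift)
      fix k assume k: "k \<in> \<Union>(set (s1 @ remove_component n s2))"
      then have "k \<in> \<Union>(set (s1 @ s2))" unfolding sub by auto
      then show "?\<tau> k = ereal b + ?\<tau>' k" using shift other[OF k] by blast
    qed
    finally show ?thesis .
  qed
  show ?thesis
  proof
    assume L: ?L
    obtain C k where C: "C \<in> set (s1 @ s2)" "k \<in> C" "l \<in> \<Gamma> k"
      using l unfolding hit_states_Union by auto
    then have k: "?\<tau> k = ereal \<sigma>" by (intro hit) auto
    have "C \<notin> set s1"
    proof
      assume "C \<in> set s1"
      then obtain r where "r \<in> set t" "ereal r < ?\<tau> k"
      proof -
        have "list_all2 (\<lambda>A r. \<forall>k\<in>A. ereal r < ?\<tau> k) s1 t"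
          using L unfolding compatible_def by blast
        moreover obtain i where "i < length s1" "s1 ! i = C"
          using \<open>C \<in> set s1\<close> by (auto simp: in_set_conv_nth)
        ultimately show thesis
          using \<open>k \<in> C\<close> that[of "t ! i"] by (auto simp: list_all2_conv_all_nth)
      qed
      then show False using k \<sigma> by force
    qed
    then obtain n where n: "n < length s2" "C = s2 ! n"
      using C by (auto simp: in_set_conv_nth)
    have "s2 = take n s2 @ s2 ! n # drop (Suc n) s2"
      using n(1) by (rule id_take_nth_drop)
    moreover define D where "D = (\<lambda>A B. \<forall>k\<in>A. \<forall>k'\<in>B. ?\<tau> k \<noteq> ?\<tau> k')"
    moreover have "sorted_wrt D (s1 @ s2)"
      using L unfolding compatible_def D_def by blast
    ultimately have "sorted_wrt D (s1 @ take n s2 @ s2 ! n # drop (Suc n) s2)"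
      by simp
    then have "D C' C \<or> D C C'" if "C' \<in> set (s1 @ remove_component n s2)" for C'
      using that n by (auto simp: sorted_wrt_append remove_component_def)
    then have other: "?\<tau> k' \<noteq> ereal \<sigma>" if "k' \<in> \<Union>(set (s1 @ remove_component n s2))" for k'
      using that C(2) k unfolding D_def by (metis UnionE)
    have "k' \<in> \<Union>(set (s1 @ s2))" if "k' \<in> \<Union>(set (s1 @ remove_component n s2))" for k'
      using that set_remove_component[OF n(1)] by auto
    then have "l \<notin> hit_states \<Gamma> (s1 @ remove_component n s2)"
      unfolding hit_states_Union using other hit by blast
    moreover have "l \<in> \<Gamma> k'" if "k' \<in> s2 ! n" for k'
    proof (rule ccontr)
      assume "l \<notin> \<Gamma> k'"
      then have "ereal \<sigma> < ?\<tau> k'" using later[of k'] that nth_mem[OF n(1)] by auto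
      moreover have "?\<tau> k' = ?\<tau> k" using L C n that unfolding compatible_def by blast
      ultimately show False using k by simp
    qed
    ultimately have "l \<in> exit_component \<Gamma> s1 s2 n" by (auto simp: exit_component_def)
    with L n(1) equiv show "\<exists>n<length s2. l \<in> exit_component \<Gamma> s1 s2 n \<and> ?R n" by blast
  qed (use equiv in blast)
qed

text \<open>All relevant hitting times exceed \<open>b\<close>, strictly because the path is still
  outside the targets at \<open>b\<close> itself. So \<open>A\<close> has passed its threshold, and
  the rest can be judged from \<open>b\<close> on.\<close>

lemma compatible_no_exit:
  assumes rc: "right_continuous_path x" and "0 \<le> b"
    and stay: "\<And>w. 0 \<le> w \<Longrightarrow> w \<le> b \<Longrightarrow> x w \<notin> hit_states \<Gamma> ((A # s1) @ s2)"
  shows "compatible (A # s1) s2 (b # t) (\<lambda>k. hit x (\<Gamma> k)) \<longleftrightarrow>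
    compatible s1 (s2 @ [A]) (map (\<lambda>r. r - b) t) (\<lambda>k. hit (\<lambda>r. x (b + r)) (\<Gamma> k))"
proof -
  let ?\<tau> = "\<lambda>k. hit x (\<Gamma> k)" and ?\<tau>' = "\<lambda>k. hit (\<lambda>r. x (b + r)) (\<Gamma> k)"
  have out: "x w \<notin> \<Gamma> k" if "k \<in> \<Union>(set ((A # s1) @ s2))" "0 \<le> w" "w \<le> b" for k w
    using stay[OF that(2,3)] that(1) unfolding hit_states_Union by blast
  then have shift: "?\<tau> k = ereal b + ?\<tau>' k" if "k \<in> \<Union>(set ((A # s1) @ s2))" for k
    using that \<open>0 \<le> b\<close> by (intro hit_shift) auto
  have "ereal b < ?\<tau> k" if "k \<in> A" for k
  proof -
    have "x b \<notin> \<Gamma> k" using out[of k b] that \<open>0 \<le> b\<close> by auto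
    then have "0 < ?\<tau>' k"
      using rc \<open>0 \<le> b\<close> by (intro hit_pos right_continuous_path_shift) auto
    then show ?thesis using shift[of k] that by (cases "?\<tau>' k") auto
  qed
  then have "compatible (A # s1) s2 (b # t) ?\<tau> \<longleftrightarrow> compatible s1 (s2 @ [A]) t ?\<tau>"
    by (rule compatible_pass_threshold)
  also have "\<dots> \<longleftrightarrow> compatible s1 (s2 @ [A]) (map (\<lambda>r. r - b) t) ?\<tau>'"
    by (rule compatible_shift, rule shift) auto
  finally show ?thesis .
qed

section \<open>The matrix exponential as a limit of powers\<close>

definition mpow :: "real^'s^'s \<Rightarrow> nat \<Rightarrow> real^'s^'s::finite" where
  "mpow A m = ((\<lambda>B. A ** B) ^^ m) (mat 1)"

lemma mpow_0 [simp]: "mpow A 0 = mat 1"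
  and mpow_Suc: "mpow A (Suc m) = A ** mpow A m"
  by (simp_all add: mpow_def)

lemma mpow_Suc2: "mpow A (Suc m) = mpow A m ** A"
  by (induction m) (simp_all add: mpow_Suc matrix_mul_assoc)

lemma matrix_mult_scaleR_left:
  "(c *\<^sub>R (A :: real^'n^'m)) ** (B :: real^'k^'n) = c *\<^sub>R (A ** B)"
  by (simp add: matrix_matrix_mult_def vec_eq_iff sum_distrib_left mult.assoc)

lemma matrix_mult_scaleR_right:
  "(A :: real^'n^'m) ** (c *\<^sub>R (B :: real^'k^'n)) = c *\<^sub>R (A ** B)"
  by (simp add: matrix_matrix_mult_def vec_eq_iff sum_distrib_left mult.left_commute)

lemma mpow_scaleR: "mpow (c *\<^sub>R A) m = c ^ m *\<^sub>R mpow A m"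
  by (induction m) (simp_all add: mpow_Suc matrix_mult_scaleR_left matrix_mult_scaleR_right mult.commute)

lemma matrix_mult_sum_right:
  "(A :: real^'n^'m) ** (\<Sum>i\<in>I. B i) = (\<Sum>i\<in>I. A ** (B i :: real^'k^'n))"
  by (induction I rule: infinite_finite_induct) (simp_all add: matrix_add_ldistrib)

lemma matrix_mult_add_left:
  "((A :: real^'n^'m) + B) ** (C :: real^'k^'n) = A ** C + B ** C"
  by (simp add: matrix_matrix_mult_def vec_eq_iff distrib_right sum.distrib)

text \<open>The binomial theorem for the identity and \<open>A\<close>, which commute, by Pascal's
  rule.\<close>

lemma mpow_one_plus:
  "mpow (mat 1 + A) n = (\<Sum>m\<le>n. real (n choose m) *\<^sub>R mpow A m)"
proof (induction n)
  case (Suc n)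
  have "mpow (mat 1 + A) (Suc n) =
      (\<Sum>m\<le>n. real (n choose m) *\<^sub>R mpow A m) + (\<Sum>m\<le>n. real (n choose m) *\<^sub>R mpow A (Suc m))"
    by (simp add: mpow_Suc Suc.IH matrix_mult_add_left matrix_mult_sum_right matrix_mult_scaleR_right
        scaleR_add_right sum.distrib)
  also have "(\<Sum>m\<le>n. real (n choose m) *\<^sub>R mpow A m) = (\<Sum>m\<le>Suc n. real (n choose m) *\<^sub>R mpow A m)"
    by (simp add: binomial_eq_0)
  also have "\<dots> = mpow A 0 + (\<Sum>m\<le>n. real (n choose Suc m) *\<^sub>R mpow A (Suc m))"
    by (subst sum.atMost_Suc_shift) simp
  also have "\<dots> + (\<Sum>m\<le>n. real (n choose m) *\<^sub>R mpow A (Suc m)) =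
      mpow A 0 + (\<Sum>m\<le>n. real (Suc n choose Suc m) *\<^sub>R mpow A (Suc m))"
    by (simp add: sum.distrib scaleR_add_left)
  also have "\<dots> = (\<Sum>m\<le>Suc n. real (Suc n choose m) *\<^sub>R mpow A m)"
    by (subst sum.atMost_Suc_shift) simp
  finally show ?case .
qed simp

text \<open>\<open>c\<close> bounds the operator norm for the maximum norm, which is
  submultiplicative and dominates every entry.\<close>

lemma mpow_entry_le:
  assumes "\<And>i. (\<Sum>j\<in>UNIV. \<bar>A $ i $ j\<bar>) \<le> c"
  shows "\<bar>mpow A m $ i $ j\<bar> \<le> c ^ m"
proof (induction m arbitrary: i)
  case 0
  then show ?case by (simp add: mat_def)
next
  case (Suc m)
  have "0 \<le> c" by (rule order_trans[OF sum_nonneg assms[of i]]) simp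
  have "\<bar>mpow A (Suc m) $ i $ j\<bar> \<le> (\<Sum>k\<in>UNIV. \<bar>A $ i $ k\<bar> * \<bar>mpow A m $ k $ j\<bar>)"
    by (simp add: mpow_Suc matrix_matrix_mult_def abs_mult[symmetric] sum_abs)
  also have "\<dots> \<le> (\<Sum>k\<in>UNIV. \<bar>A $ i $ k\<bar> * c ^ m)"
    by (intro sum_mono mult_left_mono Suc.IH) auto
  also have "\<dots> = (\<Sum>k\<in>UNIV. \<bar>A $ i $ k\<bar>) * c ^ m"
    by (simp add: sum_distrib_right)
  also have "\<dots> \<le> c * c ^ m"
    using \<open>0 \<le> c\<close> by (intro mult_right_mono assms) auto
  finally show ?case by simp
qed

lemma matrix_row_sum_bound:
  fixes A :: "real^'s^'s::finite"
  obtains c where "\<And>i. (\<Sum>j\<in>UNIV. \<bar>A $ i $ j\<bar>) \<le> c"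
proof
  show "(\<Sum>j\<in>UNIV. \<bar>A $ i $ j\<bar>) \<le> (\<Sum>i\<in>UNIV. \<Sum>j\<in>UNIV. \<bar>A $ i $ j\<bar>)" for i
    by (intro member_le_sum) (auto intro: sum_nonneg)
qed

lemma matrix_exp_entry:
  fixes A :: "real^'s^'s::finite"
  shows "(\<lambda>m. u ^ m / fact m * mpow A m $ i $ j) sums (matrix_exp (u *\<^sub>R A) $ i $ j)"
proof -
  obtain c where c: "\<And>i. (\<Sum>j\<in>UNIV. \<bar>(u *\<^sub>R A) $ i $ j\<bar>) \<le> c"
    using matrix_row_sum_bound by blast
  have sm: "summable (\<lambda>m. 1 / fact m * mpow (u *\<^sub>R A) m $ i $ j)" for i j
  proof (rule summable_comparison_test')
    show "summable (\<lambda>m. c ^ m /\<^sub>R fact m)" by (rule summable_exp_generic)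
    show "norm (1 / fact m * mpow (u *\<^sub>R A) m $ i $ j) \<le> c ^ m /\<^sub>R fact m" for m
      using mpow_entry_le[OF c, of m i j] by (simp add: abs_mult field_simps)
  qed
  have "(\<lambda>m. (1 / fact m) *\<^sub>R mpow (u *\<^sub>R A) m) sums
      (\<chi> i j. \<Sum>m. 1 / fact m * mpow (u *\<^sub>R A) m $ i $ j)"
    unfolding sums_def
    using summable_LIMSEQ[OF sm] by (intro vec_tendstoI) simp
  then have "(\<lambda>m. (1 / fact m) *\<^sub>R mpow (u *\<^sub>R A) m) sums matrix_exp (u *\<^sub>R A)"
    unfolding matrix_exp_def mpow_def[symmetric] by (simp add: sums_iff)
  then have "(\<lambda>m. ((1 / fact m) *\<^sub>R mpow (u *\<^sub>R A) m) $ i $ j) sums (matrix_exp (u *\<^sub>R A) $ i $ j)"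
    by (intro bounded_linear.sums[OF bounded_linear_vec_nth])
  then show ?thesis by (simp add: mpow_scaleR)
qed

lemma tendsto_mpow_entry:
  assumes "\<And>i j. ((\<lambda>n. A n $ i $ j) \<longlongrightarrow> L $ i $ j) F"
  shows "((\<lambda>n. mpow (A n) m $ i $ j) \<longlongrightarrow> mpow L m $ i $ j) F"
proof (induction m arbitrary: i)
  case (Suc m)
  show ?case
    unfolding mpow_Suc matrix_matrix_mult_def vec_lambda_beta
    by (intro tendsto_sum tendsto_mult assms Suc)
qed simp

text \<open>The scaled coefficient is 1/m! times the product of the m factors k h - r h, and each
  correction r h tends to 0.\<close>

lemma tendsto_binomial_scaled:
  fixes h :: "nat \<Rightarrow> real"
  assumes "h \<longlonglongrightarrow> 0" "(\<lambda>N. real (k N) * h N) \<longlonglongrightarrow> u"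
  shows "(\<lambda>N. real (k N choose m) * h N ^ m) \<longlonglongrightarrow> u ^ m / fact m"
proof -
  have "real (k N choose m) * h N ^ m = (\<Prod>r=0..<m. real (k N) * h N - real r * h N) / fact m" for N
    by (simp add: binomial_gbinomial gbinomial_prod_rev prod_power_distrib[symmetric]
        flip: left_diff_distrib) (simp add: prod.distrib)
  moreover have "(\<lambda>N. (\<Prod>r=0..<m. real (k N) * h N - real r * h N) / fact m) \<longlonglongrightarrow>
      (\<Prod>r=0..<m. u - real r * 0) / fact m"
    by (intro tendsto_intros assms) simp
  ultimately show ?thesis by simp
qed

lemma binomial_scaled_le:
  fixes h :: real
  assumes "0 \<le> h"
  shows "real (k choose m) * h ^ m \<le> (real k * h) ^ m / fact m"
proof -
  have "real (k choose m) * fact m \<le> real k ^ m"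
    using binomial_fact_pow[of k m] by (metis of_nat_fact of_nat_le_iff of_nat_mult of_nat_power)
  then have "real (k choose m) \<le> real k ^ m / fact m"
    by (simp add: field_simps)
  then show ?thesis
    using assms by (simp add: power_mult_distrib mult_right_mono flip: times_divide_eq_left)
qed

text \<open>The powers are expanded by the binomial theorem, and Tannery's theorem is applied to the
  resulting series.\<close>

lemma tendsto_mpow_matrix_exp:
  fixes A :: "nat \<Rightarrow> real^'s^'s::finite"
  assumes A: "\<And>i j. (\<lambda>N. A N $ i $ j) \<longlonglongrightarrow> L $ i $ j"
    and h: "h \<longlonglongrightarrow> 0" "\<And>N. 0 \<le> h N"
    and k: "(\<lambda>N. real (k N) * h N) \<longlonglongrightarrow> u"
  shows "(\<lambda>N. mpow (mat 1 + h N *\<^sub>R A N) (k N) $ i $ j) \<longlonglongrightarrow> matrix_exp (u *\<^sub>R L) $ i $ j"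
proof -
  obtain c0 where c0: "\<And>i. (\<Sum>j\<in>UNIV. \<bar>L $ i $ j\<bar>) \<le> c0"
    using matrix_row_sum_bound by blast
  \<comment> \<open>The slack 1 in \<open>c0 + 1\<close> and in \<open>u + 1\<close> yields bounds
    that no longer depend on large \<open>N\<close>. Their product is the argument of the dominating
    exponential series.\<close>
  have "\<forall>\<^sub>F N in sequentially. \<forall>i\<in>UNIV. (\<Sum>j\<in>UNIV. \<bar>A N $ i $ j\<bar>) < c0 + 1"
  proof (rule eventually_ball_finite)
    show "\<forall>i\<in>UNIV. \<forall>\<^sub>F N in sequentially. (\<Sum>j\<in>UNIV. \<bar>A N $ i $ j\<bar>) < c0 + 1"
    proof
      fix i
      have "(\<lambda>N. \<Sum>j\<in>UNIV. \<bar>A N $ i $ j\<bar>) \<longlonglongrightarrow> (\<Sum>j\<in>UNIV. \<bar>L $ i $ j\<bar>)"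
        by (intro tendsto_intros A)
      then show "\<forall>\<^sub>F N in sequentially. (\<Sum>j\<in>UNIV. \<bar>A N $ i $ j\<bar>) < c0 + 1"
        by (rule order_tendstoD) (use c0[of i] in linarith)
    qed
  qed simp
  moreover have "\<forall>\<^sub>F N in sequentially. real (k N) * h N < u + 1"
    using k by (rule order_tendstoD) simp
  ultimately have bound: "\<forall>\<^sub>F N in sequentially. \<forall>m.
      norm (real (k N choose m) * h N ^ m * mpow (A N) m $ i $ j) \<le> ((u + 1) * (c0 + 1)) ^ m /\<^sub>R fact m"
  proof eventually_elim
    case (elim N)
    show ?case
    proof
      fix m
      have "real (k N choose m) * h N ^ m \<le> (real (k N) * h N) ^ m / fact m"
        by (rule binomial_scaled_le) (rule h)
      also have "\<dots> \<le> (u + 1) ^ m / fact m"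
        using elim(2) h by (intro divide_right_mono power_mono) auto
      finally have "real (k N choose m) * h N ^ m \<le> (u + 1) ^ m / fact m" .
      moreover have "\<bar>mpow (A N) m $ i $ j\<bar> \<le> (c0 + 1) ^ m"
        by (rule mpow_entry_le) (use elim(1) in \<open>auto intro: less_imp_le\<close>)
      ultimately have "(real (k N choose m) * h N ^ m) * \<bar>mpow (A N) m $ i $ j\<bar> \<le>
          ((u + 1) ^ m / fact m) * (c0 + 1) ^ m"
        by (intro mult_mono') (use h in auto)
      then show "norm (real (k N choose m) * h N ^ m * mpow (A N) m $ i $ j) \<le>
          ((u + 1) * (c0 + 1)) ^ m /\<^sub>R fact m"
        using h by (simp add: abs_mult power_mult_distrib divide_inverse mult_ac)
    qed
  qed
  have "(\<lambda>N. \<Sum>m. real (k N choose m) * h N ^ m * mpow (A N) m $ i $ j) \<longlonglongrightarrow>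
      (\<Sum>m. u ^ m / fact m * mpow L m $ i $ j)"
  proof (rule tannerys_theorem[THEN conjunct2, THEN conjunct2])
    show "(\<lambda>N. real (k N choose m) * h N ^ m * mpow (A N) m $ i $ j) \<longlonglongrightarrow>
        u ^ m / fact m * mpow L m $ i $ j" for m
      by (intro tendsto_mult tendsto_binomial_scaled tendsto_mpow_entry A h k)
    show "summable (\<lambda>m. ((u + 1) * (c0 + 1)) ^ m /\<^sub>R fact m)"
      by (rule summable_exp_generic)
    show "\<forall>\<^sub>F (m, N) in sequentially \<times>\<^sub>F sequentially.
        norm (real (k N choose m) * h N ^ m * mpow (A N) m $ i $ j) \<le> ((u + 1) * (c0 + 1)) ^ m /\<^sub>R fact m"
      using eventually_prodI[OF eventually_True bound] by (rule eventually_mono) auto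
  qed simp
  \<comment> \<open>The binomial coefficients vanish beyond \<open>k N\<close>, so this series is
    the finite binomial expansion of the power.\<close>
  moreover have "(\<Sum>m. real (k N choose m) * h N ^ m * mpow (A N) m $ i $ j) =
      mpow (mat 1 + h N *\<^sub>R A N) (k N) $ i $ j" for N
  proof -
    have "(\<Sum>m. real (k N choose m) * h N ^ m * mpow (A N) m $ i $ j) =
        (\<Sum>m\<le>k N. real (k N choose m) * h N ^ m * mpow (A N) m $ i $ j)"
      by (rule suminf_finite) (auto simp: binomial_eq_0)
    then show ?thesis by (simp add: mpow_one_plus mpow_scaleR mult.assoc)
  qed
  ultimately show ?thesis
    using matrix_exp_entry[of u L i j] by (simp add: sums_iff)
qed

section \<open>The Markov property for hitting events\<close>

text \<open>The index set is [0, \<infinity>) because \<open>X\<close> is unconstrained at negative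
  times; paths enter through \<open>restrict\<close>.\<close>

definition path_space :: "(real \<Rightarrow> 's) measure" where
  "path_space = (\<Pi>\<^sub>M r\<in>{0..}. count_space UNIV)"

lemma measurable_path:
  assumes "\<And>r. 0 \<le> r \<Longrightarrow> Y r \<in> N \<rightarrow>\<^sub>M count_space UNIV"
  shows "(\<lambda>\<omega>. restrict (\<lambda>r. Y r \<omega>) {0..}) \<in> N \<rightarrow>\<^sub>M path_space"
  unfolding path_space_def by (rule measurable_restrict) (use assms in auto)

text \<open>This form of the hitting time involves only countably many coordinates, hence is
  measurable on the product space. It agrees with \<open>hit\<close> on right-continuous paths, the
  only ones to which it is applied.\<close>

lemma measurable_hit_rat:
  "(\<lambda>x. INF q\<in>\<rat> \<inter> {0<..}. if x q \<in> B then ereal q else \<infinity>) \<in> borel_measurable path_space"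
proof (intro borel_measurable_INF)
  show "countable (\<rat> \<inter> {0<..} :: real set)"
    by (intro countable_Int1 countable_rat)
  fix q :: real assume "q \<in> \<rat> \<inter> {0<..}"
  then have "(\<lambda>x. x q) \<in> path_space \<rightarrow>\<^sub>M count_space UNIV"
    unfolding path_space_def by (intro measurable_component_singleton) auto
  moreover have "(\<lambda>s. if s \<in> B then ereal q else \<infinity>) \<in> borel_measurable (count_space UNIV)"
    by simp
  ultimately show "(\<lambda>x. if x q \<in> B then ereal q else \<infinity>) \<in> borel_measurable path_space"
    by (rule measurable_compose)
qed

lemma pred_compatible:
  fixes \<tau> :: "'k \<Rightarrow> 'w \<Rightarrow> ereal"
  assumes fin: "\<forall>A\<in>set (s1 @ s2). finite A"
    and [measurable]: "\<And>k. \<tau> k \<in> borel_measurable N"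
    and len: "length t = length s1"
  shows "Measurable.pred N (\<lambda>x. compatible s1 s2 t (\<lambda>k. \<tau> k x))"
proof -
  have fin': "n < length (s1 @ s2) \<Longrightarrow> finite ((s1 @ s2) ! n)"
    "n < length s1 \<Longrightarrow> finite (s1 ! n)" "n < length s2 \<Longrightarrow> finite (s2 ! n)" for n
    using nth_mem[of n "s1 @ s2"] nth_mem[of n s1] nth_mem[of n s2] fin by auto
  have eq: "Measurable.pred N (\<lambda>x. \<tau> k x = \<tau> k' x)" for k k'
    unfolding order.eq_iff not_less[symmetric] by measurable
  have less: "Measurable.pred N (\<lambda>x. c < \<tau> k x)" for c k
    by measurable
  show ?thesis
    unfolding compatible_iff_nth[OF len]
    by (intro pred_intros_logic(2,3) pred_intros_countable(1) pred_intros_imp' pred_intros_finite(3)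
        fin' eq less)
qed

context finite_markov_process
begin

lemma space_P: "space (P i) = space M"
  using sets_P by (rule sets_eq_imp_space_eq)

lemma state_sets: "0 \<le> u \<Longrightarrow> {\<omega> \<in> space M. X u \<omega> \<in> A} \<in> sets M"
  using measurable_sets[OF measurable_X, of u A] by (simp add: vimage_def Int_def conj_commute)

lemma space_natural_filtration: "space (natural_filtration M X u) = space M"
  unfolding natural_filtration_def by (rule space_measure_of) auto

lemma sets_natural_filtration:
  "sets (natural_filtration M X u) = sigma_sets (space M) {X r -` A \<inter> space M | r A. 0 \<le> r \<and> r \<le> u}"
  unfolding natural_filtration_def by (rule sets_measure_of) auto

lemma natural_filtration_subset: "sets (natural_filtration M X u) \<subseteq> sets M"
  unfolding sets_natural_filtration
  by (rule sets.sigma_sets_subset) (auto intro: measurable_sets[OF measurable_X])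

lemma natural_filtration_mono:
  "u \<le> v \<Longrightarrow> sets (natural_filtration M X u) \<subseteq> sets (natural_filtration M X v)"
  unfolding sets_natural_filtration by (rule sigma_sets_mono') force

lemma state_in_natural_filtration:
  assumes "0 \<le> r" "r \<le> u"
  shows "{\<omega> \<in> space M. X r \<omega> \<in> A} \<in> sets (natural_filtration M X u)"
proof -
  have "{\<omega> \<in> space M. X r \<omega> \<in> A} = X r -` A \<inter> space M" by auto
  then show ?thesis
    unfolding sets_natural_filtration using assms by (intro sigma_sets.Basic) blast
qed

definition transition :: "real \<Rightarrow> 's \<Rightarrow> 's \<Rightarrow> real" where
  "transition h i j = measure (P i) {\<omega> \<in> space M. X h \<omega> = j}"

text \<open>The axiom \<open>markov\<close> is integrated over \<open>F\<close>. There
  \<open>X u\<close> is the single state \<open>l\<close>, so the conditional probability is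
  constant almost everywhere on \<open>F\<close>.\<close>

lemma markov_transition:
  assumes u: "0 \<le> u" "0 \<le> h" and F: "F \<in> sets (natural_filtration M X u)" "\<And>\<omega>. \<omega> \<in> F \<Longrightarrow> X u \<omega> = l"
  shows "measure (P i) (F \<inter> {\<omega> \<in> space M. X (u + h) \<omega> = j}) = measure (P i) F * transition h l j"
proof -
  interpret prob_space "P i" by (rule prob_space_P)
  interpret finite_measure_subalgebra "P i" "natural_filtration M X u"
    by unfold_locales (auto simp: subalgebra_def space_natural_filtration space_P sets_P
        intro: subsetD[OF natural_filtration_subset])
  let ?G = "{\<omega> \<in> space M. X (u + h) \<omega> = j}"
  let ?E = "real_cond_exp (P i) (natural_filtration M X u) (indicator ?G)"
  have G: "?G \<in> sets (P i)"
    using state_sets[of "u + h" "{j}"] u by (simp add: sets_P)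
  have F': "F \<in> sets (P i)"
    using F(1) natural_filtration_subset by (auto simp: sets_P)
  have "measure (P i) (F \<inter> ?G) = (LINT \<omega>:F|P i. indicator ?G \<omega>)"
    unfolding set_lebesgue_integral_def using F' G
    by (simp add: indicator_inter_arith[symmetric] Int_absorb1 sets.sets_into_space)
  also have "\<dots> = (LINT \<omega>:F|P i. ?E \<omega>)"
    by (rule real_cond_exp_intA) (use G F in \<open>simp_all add: integrable_indicator_iff emeasure_eq_measure\<close>)
  also have "\<dots> = (LINT \<omega>:F|P i. transition h l j)"
    unfolding set_lebesgue_integral_def
  proof (rule integral_cong_AE)
    show "AE \<omega> in P i. indicator F \<omega> *\<^sub>R ?E \<omega> = indicator F \<omega> *\<^sub>R transition h l j"
      using markov[OF u, of i j] by eventually_elim (auto simp: F(2) transition_def indicator_def)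
  qed (use F' in auto)
  also have "\<dots> = measure (P i) F * transition h l j"
    unfolding set_lebesgue_integral_def using F' sets.sets_into_space[OF F'] by (simp add: Int_absorb1)
  finally show ?thesis .
qed

lemma start_sets: "{\<omega> \<in> space M. X 0 \<omega> = l} \<in> sets (natural_filtration M X 0)"
  using state_in_natural_filtration[of 0 0 "{l}"] by simp

lemma measure_start_Int:
  assumes "G \<in> sets M"
  shows "measure (P i) ({\<omega> \<in> space M. X 0 \<omega> = i} \<inter> G) = measure (P i) G"
proof -
  interpret prob_space "P i" by (rule prob_space_P)
  have "prob (G \<inter> {\<omega> \<in> space M. X 0 \<omega> = i}) = prob G"
    by (rule measure_space_inter)
      (use assms start state_sets[of 0 "{i}"] in \<open>simp_all add: sets_P prob_space\<close>)
  then show ?thesis by (simp add: Int_commute)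
qed

lemma cylinder_sets:
  assumes "finite J" "J \<subseteq> {0..}" "0 \<le> u"
  shows "{\<omega> \<in> space M. \<forall>r\<in>J. X (u + r) \<omega> \<in> B r} \<in> sets M"
proof -
  have "{\<omega> \<in> space M. \<forall>r\<in>J. X (u + r) \<omega> \<in> B r} =
      (\<Inter>r\<in>J. {\<omega> \<in> space M. X (u + r) \<omega> \<in> B r}) \<inter> space M"
    by auto
  also have "\<dots> \<in> sets M"
  proof (cases "J = {}")
    case False
    then show ?thesis
      using assms by (intro sets.Int sets.finite_INT sets.top state_sets) auto
  qed simp
  finally show ?thesis .
qed

text \<open>Induction on the number of times. The earliest time \<open>r0\<close> is handled by
  \<open>markov_transition\<close>; the induction hypothesis then applies at time
  \<open>u + r0\<close> on the part of \<open>F\<close> with a given state at that time.\<close>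

lemma markov_cylinder:
  assumes "finite J" "J \<subseteq> {0..}" "0 \<le> u" "F \<in> sets (natural_filtration M X u)"
    "\<And>\<omega>. \<omega> \<in> F \<Longrightarrow> X u \<omega> = l"
  shows "measure (P i) (F \<inter> {\<omega> \<in> space M. \<forall>r\<in>J. X (u + r) \<omega> \<in> B r}) =
    measure (P i) F * measure (P l) {\<omega> \<in> space M. \<forall>r\<in>J. X r \<omega> \<in> B r}"
  using assms
proof (induction "card J" arbitrary: J u F l i B)
  case 0
  interpret Pl: prob_space "P l" by (rule prob_space_P)
  have "F \<subseteq> space M"
    using 0 natural_filtration_subset sets.sets_into_space by blast
  with 0 show ?case by (simp add: Int_absorb2 Pl.prob_space[unfolded space_P])
next
  case (Suc n)
  define r0 where "r0 = Min J"
  have "J \<noteq> {}" using Suc by auto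
  then have r0: "r0 \<in> J" "\<And>r. r \<in> J \<Longrightarrow> r0 \<le> r" "0 \<le> r0"
    using Suc.prems(1,2) by (auto simp: r0_def)
  define J' where "J' = (\<lambda>r. r - r0) ` (J - {r0})"
  define B' where "B' r = B (r0 + r)" for r
  define C where "C j = {\<omega> \<in> space M. \<forall>r\<in>J'. X r \<omega> \<in> B' r}" for j :: 's
  have J': "finite J'" "J' \<subseteq> {0..}" "n = card J'"
  proof -
    show "n = card J'"
      unfolding J'_def using Suc.hyps(2) Suc.prems(1) r0(1)
      by (subst card_image) (auto simp: inj_on_def)
  qed (use Suc.prems r0 in \<open>auto simp: J'_def\<close>)
  have J_iff: "(\<forall>r\<in>J. X (u + r) \<omega> \<in> B r) \<longleftrightarrow>
      X (u + r0) \<omega> \<in> B r0 \<and> (\<forall>r\<in>J'. X (u + r0 + r) \<omega> \<in> B' r)" for u \<omega>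
  proof -
    have "J = insert r0 (J - {r0})" using r0(1) by auto
    then have "(\<forall>r\<in>J. X (u + r) \<omega> \<in> B r) \<longleftrightarrow>
        X (u + r0) \<omega> \<in> B r0 \<and> (\<forall>r\<in>J - {r0}. X (u + r) \<omega> \<in> B r)" by blast
    then show ?thesis by (simp add: J'_def B'_def)
  qed
  define c where "c l = (\<Sum>j\<in>B r0. transition r0 l j * measure (P j) {\<omega> \<in> space M. \<forall>r\<in>J'. X r \<omega> \<in> B' r})" for l
  \<comment> \<open>Stated for arbitrary \<open>u\<close>, \<open>F\<close>, \<open>l\<close> and
    \<open>i\<close> because it is used twice: for the goal, and at time 0 with \<open>F\<close> the
    event that \<open>X 0\<close> is \<open>l\<close>, which identifies \<open>c l\<close> as the
    probability under \<open>P l\<close>.\<close>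
  have step: "measure (P i) (F \<inter> {\<omega> \<in> space M. \<forall>r\<in>J. X (u + r) \<omega> \<in> B r}) = measure (P i) F * c l"
    if u: "0 \<le> u" and F: "F \<in> sets (natural_filtration M X u)" "\<And>\<omega>. \<omega> \<in> F \<Longrightarrow> X u \<omega> = l" for u F l i
  proof -
    interpret prob_space "P i" by (rule prob_space_P)
    define G where "G j = F \<inter> {\<omega> \<in> space M. X (u + r0) \<omega> = j}" for j
    have G: "G j \<in> sets (natural_filtration M X (u + r0))" for j
      using state_in_natural_filtration[of "u + r0" "u + r0" "{j}"] u r0 F(1)
        natural_filtration_mono[of u "u + r0"] by (auto simp: G_def)
    define H where "H j = G j \<inter> {\<omega> \<in> space M. \<forall>r\<in>J'. X (u + r0 + r) \<omega> \<in> B' r}" for j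
    have "F \<subseteq> space M"
      using F natural_filtration_subset sets.sets_into_space by blast
    then have "F \<inter> {\<omega> \<in> space M. \<forall>r\<in>J. X (u + r) \<omega> \<in> B r} = (\<Union>j\<in>B r0. H j)"
      unfolding J_iff H_def G_def by auto
    moreover have "prob (\<Union>j\<in>B r0. H j) = (\<Sum>j\<in>B r0. prob (H j))"
    proof (rule finite_measure_finite_Union)
      show "H ` B r0 \<subseteq> events"
        using G natural_filtration_subset cylinder_sets[OF J'(1,2), of "u + r0"] u r0
        by (auto simp: H_def sets_P intro!: sets.Int)
      show "disjoint_family_on H (B r0)"
        by (auto simp: disjoint_family_on_def H_def G_def)
    qed simp
    moreover have "prob (H j) = prob F * (transition r0 l j * measure (P j) {\<omega> \<in> space M. \<forall>r\<in>J'. X r \<omega> \<in> B' r})" for j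
    proof -
      have "prob (H j) = prob (G j) * measure (P j) {\<omega> \<in> space M. \<forall>r\<in>J'. X r \<omega> \<in> B' r}"
        unfolding H_def by (rule Suc.hyps(1)[OF J'(3,1,2)]) (use u r0 G in \<open>auto simp: G_def\<close>)
      also have "prob (G j) = prob F * transition r0 l j"
        unfolding G_def by (rule markov_transition) (use u r0 F in auto)
      finally show ?thesis by simp
    qed
    ultimately show ?thesis by (simp add: c_def sum_distrib_left)
  qed
  have "measure (P l) {\<omega> \<in> space M. \<forall>r\<in>J. X r \<omega> \<in> B r} = c l"
  proof -
    have "measure (P l) ({\<omega> \<in> space M. X 0 \<omega> = l} \<inter> {\<omega> \<in> space M. \<forall>r\<in>J. X (0 + r) \<omega> \<in> B r}) =
        measure (P l) {\<omega> \<in> space M. X 0 \<omega> = l} * c l"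
      by (rule step[OF order_refl start_sets]) simp
    then show ?thesis
      using measure_start_Int[OF cylinder_sets[OF Suc.prems(1,2), of 0 B], of l] start[of l] by simp
  qed
  with step[OF Suc.prems(3-5)] show ?case by simp
qed

text \<open>As functions of \<open>H\<close>, both sides are finite measures: the law of the future
  path on \<open>F\<close>, and the law of \<open>X\<close> under \<open>P l\<close> scaled by the
  mass of \<open>F\<close>. They agree on cylinders, which determine a finite measure on the product
  sigma-algebra.\<close>

lemma markov_path:
  assumes u: "0 \<le> u" and F: "F \<in> sets (natural_filtration M X u)" "\<And>\<omega>. \<omega> \<in> F \<Longrightarrow> X u \<omega> = l"
    and H: "H \<in> sets path_space"
  shows "measure (P i) (F \<inter> {\<omega> \<in> space M. restrict (\<lambda>r. X (u + r) \<omega>) {0..} \<in> H}) =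
    measure (P i) F * measure (P l) {\<omega> \<in> space M. restrict (\<lambda>r. X r \<omega>) {0..} \<in> H}"
proof -
  interpret Pi: prob_space "P i" by (rule prob_space_P)
  interpret Pl: prob_space "P l" by (rule prob_space_P)
  have F': "F \<in> sets (P i)"
    using F(1) natural_filtration_subset by (auto simp: sets_P)
  then have "F \<subseteq> space M"
    using sets.sets_into_space[of F M] by (simp add: sets_P)
  let ?f = "\<lambda>\<omega>. restrict (\<lambda>r. X (u + r) \<omega>) {0..}" and ?g = "\<lambda>\<omega>. restrict (\<lambda>r. X r \<omega>) {0..}"
  let ?\<mu> = "distr (density (P i) (indicator F)) path_space ?f"
  let ?\<nu> = "scale_measure (ennreal (measure (P i) F)) (distr (P l) path_space ?g)"
  have mf: "?f \<in> M \<rightarrow>\<^sub>M path_space" and mg: "?g \<in> M \<rightarrow>\<^sub>M path_space"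
    using u by (auto intro!: measurable_path measurable_X)
  then have mf': "?f \<in> density (P i) (indicator F) \<rightarrow>\<^sub>M path_space" and mg': "?g \<in> P l \<rightarrow>\<^sub>M path_space"
    by (simp_all add: measurable_cong_sets[OF sets_P refl])
  have \<mu>: "emeasure ?\<mu> H = ennreal (measure (P i) (F \<inter> {\<omega> \<in> space M. ?f \<omega> \<in> H}))"
    and \<nu>: "emeasure ?\<nu> H = ennreal (measure (P i) F * measure (P l) {\<omega> \<in> space M. ?g \<omega> \<in> H})"
    if "H \<in> sets path_space" for H
  proof -
    have V: "{\<omega> \<in> space M. ?f \<omega> \<in> H} \<in> sets (P i)"
      using measurable_sets[OF mf that] by (simp add: sets_P vimage_def Int_def conj_commute)
    have "emeasure ?\<mu> H = emeasure (density (P i) (indicator F)) {\<omega> \<in> space M. ?f \<omega> \<in> H}"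
      using that mf' by (simp add: emeasure_distr space_P vimage_def Int_def conj_commute)
    then show "emeasure ?\<mu> H = ennreal (measure (P i) (F \<inter> {\<omega> \<in> space M. ?f \<omega> \<in> H}))"
      by (simp add: emeasure_restricted[OF F' V] Pi.emeasure_eq_measure)
    show "emeasure ?\<nu> H = ennreal (measure (P i) F * measure (P l) {\<omega> \<in> space M. ?g \<omega> \<in> H})"
      using that mg'
      by (simp add: emeasure_distr space_P Pl.emeasure_eq_measure vimage_def Int_def conj_ac ennreal_mult)
  qed
  have "?\<mu> = ?\<nu>"
  proof (rule measure_eqI_PiM_infinite)
    show "sets ?\<mu> = sets (\<Pi>\<^sub>M r\<in>{0..}. count_space UNIV)" "sets ?\<nu> = sets (\<Pi>\<^sub>M r\<in>{0..}. count_space UNIV)"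
      by (simp_all add: path_space_def)
    show "finite_measure ?\<mu>"
    proof
      show "emeasure ?\<mu> (space ?\<mu>) \<noteq> \<infinity>"
        using \<mu>[OF sets.top] by simp
    qed
  next
    fix A :: "real \<Rightarrow> 's set" and J :: "real set"
    assume J: "finite J" "J \<subseteq> {0..}"
    let ?H = "prod_emb {0..} (\<lambda>_. count_space UNIV) J (Pi\<^sub>E J A)"
    have "?H \<in> sets path_space"
      unfolding path_space_def using J by (intro sets_PiM_I) auto
    moreover have "{\<omega> \<in> space M. ?f \<omega> \<in> ?H} = {\<omega> \<in> space M. \<forall>r\<in>J. X (u + r) \<omega> \<in> A r}"
      "{\<omega> \<in> space M. ?g \<omega> \<in> ?H} = {\<omega> \<in> space M. \<forall>r\<in>J. X r \<omega> \<in> A r}"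
      using J by (auto simp: prod_emb_def PiE_iff Int_absorb1 restrict_restrict subset_iff)
    ultimately show "emeasure ?\<mu> ?H = emeasure ?\<nu> ?H"
      by (simp only: \<mu> \<nu> markov_cylinder[OF J u F])
  qed
  then have "ennreal (measure (P i) (F \<inter> {\<omega> \<in> space M. ?f \<omega> \<in> H})) =
      ennreal (measure (P i) F * measure (P l) {\<omega> \<in> space M. ?g \<omega> \<in> H})"
    using \<mu>[OF H] \<nu>[OF H] by simp
  then show ?thesis by simp
qed

lemma right_continuous_path_X:
  assumes "\<omega> \<in> space M"
  shows "right_continuous_path (\<lambda>r. X r \<omega>)"
  using right_continuous_X[OF assms] by (auto simp: right_continuous_path_def)

text \<open>One and the same \<open>H\<close> serves every \<open>u\<close>. This lets
  \<open>markov_path\<close> turn the event for the shifted process into the event for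
  \<open>X\<close> itself.\<close>

lemma hitting_event_path:
  fixes \<Gamma> :: "'k \<Rightarrow> 's set"
  assumes "\<forall>A\<in>set (s1 @ s2). finite A" "length t = length s1"
  shows "\<exists>H\<in>sets path_space. \<forall>u\<ge>0. hitting_event M (\<lambda>r. X (u + r)) \<Gamma> s1 s2 t =
      {\<omega> \<in> space M. restrict (\<lambda>r. X (u + r) \<omega>) {0..} \<in> H}"
proof (intro bexI allI impI)
  let ?\<tau> = "\<lambda>k x. INF q\<in>\<rat> \<inter> {0<..}. if x q \<in> \<Gamma> k then ereal q else \<infinity>"
  let ?H = "{x \<in> space path_space. compatible s1 s2 t (\<lambda>k. ?\<tau> k x)}"
  show "?H \<in> sets path_space"
    using pred_compatible[of s1 s2 ?\<tau> path_space t, OF assms(1) measurable_hit_rat assms(2)]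
    by (simp add: pred_def)
  show "hitting_event M (\<lambda>r. X (u + r)) \<Gamma> s1 s2 t =
      {\<omega> \<in> space M. restrict (\<lambda>r. X (u + r) \<omega>) {0..} \<in> ?H}" if "0 \<le> u" for u
  proof -
    have "hit (\<lambda>r. X (u + r) \<omega>) (\<Gamma> k) = ?\<tau> k (restrict (\<lambda>r. X (u + r) \<omega>) {0..})"
      if "\<omega> \<in> space M" for \<omega> k
      using right_continuous_path_shift[OF right_continuous_path_X[OF that] \<open>0 \<le> u\<close>]
      by (simp add: hit_eq_INF_rat)
    moreover have "restrict (\<lambda>r. X (u + r) \<omega>) {0..} \<in> space path_space" for \<omega>
      by (simp add: path_space_def space_PiM)
    ultimately show ?thesis
      unfolding hitting_event_eq_compatible[OF assms(2)]
      by (intro Collect_cong conj_cong refl) (simp only: mem_Collect_eq simp_thms)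
  qed
qed

lemma hitting_event_sets:
  fixes \<Gamma> :: "'k \<Rightarrow> 's set"
  assumes "\<forall>A\<in>set (s1 @ s2). finite A" "length t = length s1" "0 \<le> u"
  shows "hitting_event M (\<lambda>r. X (u + r)) \<Gamma> s1 s2 t \<in> sets M"
proof -
  obtain H where H: "H \<in> sets path_space" and "\<And>u. 0 \<le> u \<Longrightarrow> hitting_event M (\<lambda>r. X (u + r)) \<Gamma> s1 s2 t =
      {\<omega> \<in> space M. restrict (\<lambda>r. X (u + r) \<omega>) {0..} \<in> H}"
    using hitting_event_path[OF assms(1,2)] by blast
  moreover have "(\<lambda>\<omega>. restrict (\<lambda>r. X (u + r) \<omega>) {0..}) \<in> M \<rightarrow>\<^sub>M path_space"
    using \<open>0 \<le> u\<close> by (auto intro!: measurable_path measurable_X)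
  ultimately show ?thesis
    using measurable_sets[of _ M path_space H] \<open>0 \<le> u\<close>
    by (simp add: vimage_def Int_def conj_commute)
qed

lemma markov_hitting_event:
  fixes \<Gamma> :: "'k \<Rightarrow> 's set"
  assumes "\<forall>A\<in>set (s1 @ s2). finite A" "length t = length s1"
    and u: "0 \<le> u" and F: "F \<in> sets (natural_filtration M X u)" "\<And>\<omega>. \<omega> \<in> F \<Longrightarrow> X u \<omega> = l"
  shows "measure (P i) (F \<inter> hitting_event M (\<lambda>r. X (u + r)) \<Gamma> s1 s2 t) =
    measure (P i) F * measure (P l) (hitting_event M X \<Gamma> s1 s2 t)"
proof -
  obtain H where "H \<in> sets path_space" and H: "\<And>u. 0 \<le> u \<Longrightarrow> hitting_event M (\<lambda>r. X (u + r)) \<Gamma> s1 s2 t =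
      {\<omega> \<in> space M. restrict (\<lambda>r. X (u + r) \<omega>) {0..} \<in> H}"
    using hitting_event_path[OF assms(1,2)] by blast
  have "hitting_event M X \<Gamma> s1 s2 t = {\<omega> \<in> space M. restrict (\<lambda>r. X r \<omega>) {0..} \<in> H}"
    using H[of 0] by simp
  then show ?thesis
    using markov_path[OF u F \<open>H \<in> _\<close>] H[OF u] by simp
qed

end

section \<open>Decomposition at the first exit\<close>

lemma step_function_integral:
  fixes f :: "nat \<Rightarrow> real"
  assumes "0 < h"
  shows "(LBINT u:{0..<real n * h}. f (nat \<lfloor>u / h\<rfloor>)) = (\<Sum>k<n. f k * h)"
proof -
  have floor_iff: "nat \<lfloor>u / h\<rfloor> = k \<longleftrightarrow> u \<in> {real k * h..<real (Suc k) * h}" if "0 \<le> u" for u k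
  proof -
    have "0 \<le> \<lfloor>u / h\<rfloor>" using that assms by simp
    then have "nat \<lfloor>u / h\<rfloor> = k \<longleftrightarrow> \<lfloor>u / h\<rfloor> = int k" by auto
    also have "\<dots> \<longleftrightarrow> real k \<le> u / h \<and> u / h < real k + 1"
      by (simp add: floor_eq_iff)
    finally show ?thesis using assms by (simp add: field_simps)
  qed
  have "indicator {0..<real n * h} u *\<^sub>R f (nat \<lfloor>u / h\<rfloor>) =
      (\<Sum>k<n. indicator {real k * h..<real (Suc k) * h} u *\<^sub>R f k)" for u
  proof (cases "0 \<le> u \<and> u < real n * h")
    case True
    then have "u / h < real n" "0 \<le> u / h" using assms by (simp_all add: field_simps)
    then have "nat \<lfloor>u / h\<rfloor> < n" by linarith
    moreover have "indicator {real k * h..<real (Suc k) * h} u = (if k = nat \<lfloor>u / h\<rfloor> then 1 else 0 :: real)" for k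
    proof -
      have "u \<in> {real k * h..<real (Suc k) * h} \<longleftrightarrow> k = nat \<lfloor>u / h\<rfloor>"
        using floor_iff[of u k] True by metis
      then show ?thesis by (simp add: indicator_def del: atLeastLessThan_iff)
    qed
    ultimately show ?thesis using True by (simp add: if_distrib[of "\<lambda>c. c * _"] cong: if_cong)
  next
    case False
    have "u \<notin> {real k * h..<real (Suc k) * h}" if "k < n" for k
    proof
      assume u: "u \<in> {real k * h..<real (Suc k) * h}"
      have "0 \<le> real k * h" "real (Suc k) * h \<le> real n * h"
        using assms that by (auto intro!: mult_right_mono)
      then show False using u False by (simp only: atLeastLessThan_iff) linarith
    qed
    then show ?thesis using False by simp
  qed
  then have "(LBINT u:{0..<real n * h}. f (nat \<lfloor>u / h\<rfloor>)) =
      (LBINT u. \<Sum>k<n. indicator {real k * h..<real (Suc k) * h} u *\<^sub>R f k)"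
    unfolding set_lebesgue_integral_def by simp
  also have "\<dots> = (\<Sum>k<n. f k * h)"
  proof (subst Bochner_Integration.integral_sum)
    have le: "real k * h \<le> real (Suc k) * h" for k
      using assms by (intro mult_right_mono) auto
    show "integrable lborel (\<lambda>u. indicator {real k * h..<real (Suc k) * h} u *\<^sub>R f k)" for k
      using emeasure_lborel_Ico[OF le[of k]]
      by (intro integrable_scaleR_left integrable_real_indicator) auto
    have "measure lborel {real k * h..<real (Suc k) * h} = h" for k
      using measure_lborel_Ico[OF le[of k]] by (simp add: algebra_simps)
    then show "(\<Sum>k<n. LBINT u. indicator {real k * h..<real (Suc k) * h} u *\<^sub>R f k) = (\<Sum>k<n. f k * h)"
      by (simp add: mult.commute)
  qed
  finally show ?thesis .
qed

text \<open>With k the integer part of u / h, the sum is the integral of a bounded step function,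
  and dominated convergence applies. The weight \<open>m\<close> is taken at the left end of a cell
  and \<open>g\<close> at the right end, since survival is observed up to grid index k and the exit
  at k + 1. The two ends merge in the limit wherever \<open>g\<close> is continuous, and a monotone
  function has only countably many discontinuities.\<close>

lemma riemann_sum_limit:
  fixes m :: "nat \<Rightarrow> nat \<Rightarrow> real" and g :: "real \<Rightarrow> real" and T :: real
  defines "h \<equiv> \<lambda>N. T / real (Suc N)"
  assumes T: "0 < T"
    and m: "\<And>u \<kappa>. (\<lambda>N. real (\<kappa> N) * h N) \<longlonglongrightarrow> u \<Longrightarrow> (\<lambda>N. m N (\<kappa> N)) \<longlonglongrightarrow> \<phi> u"
    and m_le: "\<And>N k. \<bar>m N k\<bar> \<le> 1"
    and q: "(\<lambda>N. q N / h N) \<longlonglongrightarrow> c"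
    and g: "mono g" "\<And>u. \<bar>g u\<bar> \<le> 1"
    and \<phi> [measurable]: "\<phi> \<in> borel_measurable borel"
  shows "set_integrable lborel {0..T} (\<lambda>u. \<phi> u * c * g u)"
    and "(\<lambda>N. \<Sum>k<Suc N. m N k * q N * g (real (Suc k) * h N)) \<longlonglongrightarrow> (LBINT u:{0..T}. \<phi> u * c * g u)"
proof -
  have h: "0 < h N" for N using T by (simp add: h_def)
  have h0: "h \<longlonglongrightarrow> 0"
    unfolding h_def by (rule LIMSEQ_Suc[OF lim_const_over_n])
  have g_meas [measurable]: "g \<in> borel_measurable borel"
    using g(1) by (rule borel_measurable_mono)
  obtain K where K: "\<And>N. \<bar>q N / h N\<bar> \<le> K"
    using convergent_imp_Bseq[OF convergentI[OF q]] by (auto simp: Bseq_def)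
  let ?\<kappa> = "\<lambda>N u. nat \<lfloor>u / h N\<rfloor>"
  let ?f = "\<lambda>N k. m N k * (q N / h N) * g (real (Suc k) * h N)"
  let ?s = "\<lambda>N u. indicator {0..<T} u *\<^sub>R ?f N (?\<kappa> N u)"
  let ?w = "\<lambda>u. indicator {0..T} u * K"
  let ?F = "\<lambda>u. indicator {0..T} u *\<^sub>R (\<phi> u * c * g u)"
  have sum: "(\<Sum>k<Suc N. m N k * q N * g (real (Suc k) * h N)) = (LBINT u. ?s N u)" for N
  proof -
    have "real (Suc N) * h N = T" by (simp add: h_def)
    then show ?thesis
      using step_function_integral[OF h[of N], of "Suc N" "?f N"] h[of N]
      by (simp add: set_lebesgue_integral_def del: sum.lessThan_Suc)
  qed
  have "countable {u. \<not> isCont g u}"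
    using g(1) by (rule mono_ctble_discont)
  \<comment> \<open>\<open>T\<close> joins the exceptional set because the step functions live on
    [0, T) and the limit on [0, T].\<close>
  then have "AE u in lborel. u \<notin> insert T {u. \<not> isCont g u}"
    by (intro AE_not_in countable_imp_null_set_lborel) simp
  then have lim: "AE u in lborel. (\<lambda>N. ?s N u) \<longlonglongrightarrow> ?F u"
  proof eventually_elim
    case (elim u)
    then have u: "u \<noteq> T" "isCont g u" by auto
    show ?case
    proof (cases "0 \<le> u \<and> u < T")
      case True
      have \<kappa>: "real (?\<kappa> N u) * h N \<le> u" "u \<le> real (?\<kappa> N u) * h N + h N" for N
      proof -
        have "real (?\<kappa> N u) \<le> u / h N" "u / h N \<le> real (?\<kappa> N u) + 1"
          using True h[of N] by (simp_all add: of_nat_floor)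
        then show "real (?\<kappa> N u) * h N \<le> u" "u \<le> real (?\<kappa> N u) * h N + h N"
          using h[of N] by (simp_all add: field_simps)
      qed
      have lim_\<kappa>: "(\<lambda>N. real (?\<kappa> N u) * h N) \<longlonglongrightarrow> u"
      proof (rule tendsto_sandwich)
        show "(\<lambda>N. u - h N) \<longlonglongrightarrow> u" using tendsto_diff[OF tendsto_const h0, of u] by simp
        show "\<forall>\<^sub>F N in sequentially. u - h N \<le> real (?\<kappa> N u) * h N"
          using \<kappa>(2) by (auto simp: algebra_simps)
      qed (use \<kappa>(1) in auto)
      have "(\<lambda>N. real (?\<kappa> N u) * h N + h N) \<longlonglongrightarrow> u + 0"
        by (intro tendsto_add lim_\<kappa> h0)
      then have "(\<lambda>N. real (Suc (?\<kappa> N u)) * h N) \<longlonglongrightarrow> u"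
        by (simp add: algebra_simps)
      then have "(\<lambda>N. g (real (Suc (?\<kappa> N u)) * h N)) \<longlonglongrightarrow> g u"
        by (rule isCont_tendsto_compose[OF u(2)])
      then have "(\<lambda>N. ?f N (?\<kappa> N u)) \<longlonglongrightarrow> \<phi> u * c * g u"
        by (intro tendsto_mult m lim_\<kappa> q)
      then show ?thesis using True by simp
    next
      case False
      with u have "u \<notin> {0..<T}" "u \<notin> {0..T}" by auto
      then show ?thesis by simp
    qed
  qed
  have bound: "AE u in lborel. norm (?s N u) \<le> ?w u" for N
  proof (rule AE_I2)
    fix u
    have "0 \<le> K" using K[of 0] by linarith
    moreover from this have "\<bar>?f N (?\<kappa> N u)\<bar> \<le> 1 * K * 1"
      unfolding abs_mult by (intro mult_mono m_le g K) auto
    ultimately show "norm (?s N u) \<le> ?w u"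
      by (auto simp: indicator_def)
  qed
  have meas: "?s N \<in> borel_measurable lborel" for N
    by measurable
  have w: "integrable lborel ?w"
    using T by (intro integrable_mult_left integrable_real_indicator) auto
  have F: "?F \<in> borel_measurable lborel"
    by measurable
  show "set_integrable lborel {0..T} (\<lambda>u. \<phi> u * c * g u)"
    unfolding set_integrable_def
    by (rule integrable_dominated_convergence[OF F meas w lim bound])
  show "(\<lambda>N. \<Sum>k<Suc N. m N k * q N * g (real (Suc k) * h N)) \<longlonglongrightarrow> (LBINT u:{0..T}. \<phi> u * c * g u)"
    unfolding sum set_lebesgue_integral_def
    by (rule integral_dominated_convergence[OF F meas w lim bound])
qed

section \<open>Reading the event off the grid\<close>

lemma exit_component_subset_hit_states:
  assumes "n < length s2" "{} \<notin> set s2"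
  shows "exit_component \<Gamma> s1 s2 n \<subseteq> hit_states \<Gamma> (s1 @ s2)"
proof -
  obtain k where "k \<in> s2 ! n" using assms nth_mem by (metis ex_in_conv)
  then show ?thesis using nth_mem[OF assms(1)] by (auto simp: exit_component_def hit_states_Union)
qed

text \<open>With at most one jump per cell, each value inside a cell equals the value at one of its
  end points.\<close>

lemma stay_between_grid_points:
  fixes x :: "real \<Rightarrow> 's"
  assumes h: "0 < h"
    and cell: "\<And>r. r < k \<Longrightarrow> \<exists>\<sigma>. real r * h < \<sigma> \<and> \<sigma> \<le> real (Suc r) * h \<and>
      (\<forall>w. real r * h \<le> w \<and> w < \<sigma> \<longrightarrow> x w = x (real r * h)) \<and>
      (\<forall>w. \<sigma> \<le> w \<and> w \<le> real (Suc r) * h \<longrightarrow> x w = x (real (Suc r) * h))"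
    and grid: "\<And>r. r \<le> k \<Longrightarrow> x (real r * h) \<in> W"
    and w: "0 \<le> w" "w \<le> real k * h"
  shows "x w \<in> W"
proof (cases "w = real k * h")
  case False
  define r where "r = nat \<lfloor>w / h\<rfloor>"
  have "0 \<le> w / h" "w / h < real k" using False w h by (simp_all add: field_simps)
  then have "r < k" "real r \<le> w / h" "w / h \<le> real r + 1" by (simp_all add: r_def) linarith+
  then have r: "r < k" "real r * h \<le> w" "w \<le> real (Suc r) * h"
    using h by (simp_all add: field_simps)
  then show ?thesis
    using cell[OF r(1)] grid[of r] grid[of "Suc r"] by (metis Suc_leI less_imp_le not_less)
qed (use grid in auto)

lemma sum_of_bool_unique:
  assumes "finite I" "\<And>m n. m \<in> I \<Longrightarrow> n \<in> I \<Longrightarrow> p m \<Longrightarrow> p n \<Longrightarrow> m = n"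
  shows "(\<Sum>n\<in>I. of_bool (p n)) = (of_bool (\<exists>n\<in>I. p n) :: real)"
proof (cases "\<exists>n\<in>I. p n")
  case True
  then obtain n where n: "n \<in> I" "p n" by blast
  then have "of_bool (p m) = (if m = n then 1 else 0 :: real)" if "m \<in> I" for m
    using that assms(2) by auto
  then have "(\<Sum>m\<in>I. of_bool (p m)) = (\<Sum>m\<in>I. if m = n then 1 else 0 :: real)"
    by (intro sum.cong) auto
  then show ?thesis using assms(1) n by auto
qed auto

text \<open>Let \<open>Suc k0\<close> be the first grid index outside \<open>W\<close>. Terms with k
  < k0 vanish because T_n is disjoint from \<open>W\<close>, those with k > k0 because the path has
  already left \<open>W\<close>. In the cell of k0 the single jump leads from \<open>W\<close>
  straight to the state at the right end, as \<open>compatible_exit\<close> requires. Since the T_n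
  are disjoint, at most one term equals 1, so the indicator is a plain sum to which the Markov
  property applies term by term.\<close>

lemma compatible_grid:
  fixes x :: "real \<Rightarrow> 's::finite" and N :: nat and h :: real
  defines "G \<equiv> \<lambda>k. real k * h"
  assumes rc: "right_continuous_path x" and h: "0 < h"
    and cell: "\<And>r. r < Suc N \<Longrightarrow> \<exists>\<sigma>. real r * h < \<sigma> \<and> \<sigma> \<le> real (Suc r) * h \<and>
      (\<forall>w. real r * h \<le> w \<and> w < \<sigma> \<longrightarrow> x w = x (real r * h)) \<and>
      (\<forall>w. \<sigma> \<le> w \<and> w \<le> real (Suc r) * h \<longrightarrow> x w = x (real (Suc r) * h))"
    and t: "G (Suc N) = t1" "\<forall>r\<in>set ts. t1 \<le> r"
    and W: "W = - hit_states \<Gamma> ((A # s1) @ s2)"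
    and start: "x 0 \<in> W" and ne: "{} \<notin> set s2"
  shows "of_bool (compatible (A # s1) s2 (t1 # ts) (\<lambda>k. hit x (\<Gamma> k))) =
    (\<Sum>k<Suc N. \<Sum>n<length s2. \<Sum>l\<in>exit_component \<Gamma> (A # s1) s2 n.
       of_bool (((\<forall>r\<le>k. x (G r) \<in> W) \<and> x (G (Suc k)) = l) \<and>
         compatible (A # s1) (remove_component n s2) (map (\<lambda>r. r - G (Suc k)) (t1 # ts))
           (\<lambda>i. hit (\<lambda>r. x (G (Suc k) + r)) (\<Gamma> i)))) +
    (of_bool ((\<forall>r\<le>Suc N. x (G r) \<in> W) \<and>
       compatible s1 (s2 @ [A]) (map (\<lambda>r. r - t1) ts) (\<lambda>i. hit (\<lambda>r. x (t1 + r)) (\<Gamma> i))) :: real)"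
    (is "_ = (\<Sum>k<_. \<Sum>n<_. \<Sum>l\<in>?T n. of_bool (?S k l \<and> ?C k n)) + of_bool (?stay \<and> ?D)")
proof -
  have inner: "(\<Sum>l\<in>?T n. of_bool (?S k l \<and> ?C k n)) =
      (of_bool ((\<forall>r\<le>k. x (G r) \<in> W) \<and> x (G (Suc k)) \<in> ?T n \<and> ?C k n) :: real)" for k n
    by (subst sum_of_bool_unique) auto
  have T_W: "l \<notin> W" if "l \<in> ?T n" "n < length s2" for l n
    using exit_component_subset_hit_states[OF that(2) ne, of \<Gamma> "A # s1"] that(1) unfolding W by auto
  show ?thesis
  proof (cases ?stay)
    case True
    have "x w \<in> W" if "0 \<le> w" "w \<le> t1" for w
      by (rule stay_between_grid_points[OF h, of "Suc N"]) (use cell True that t(1) in \<open>auto simp: G_def\<close>)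
    moreover have "0 \<le> t1" using t(1) h by (auto simp: G_def)
    ultimately have "compatible (A # s1) s2 (t1 # ts) (\<lambda>k. hit x (\<Gamma> k)) \<longleftrightarrow> ?D"
      by (intro compatible_no_exit[OF rc]) (auto simp: W)
    moreover have "x (G (Suc k)) \<notin> ?T n" if "k < Suc N" "n < length s2" for k n
      using True that T_W by (metis Suc_leI)
    then have "(\<Sum>k<Suc N. \<Sum>n<length s2. \<Sum>l\<in>?T n. of_bool (?S k l \<and> ?C k n)) = (0 :: real)"
      unfolding inner by (intro sum.neutral ballI) auto
    ultimately show ?thesis using True by simp
  next
    case False
    define j where "j = (LEAST r. x (G r) \<notin> W)"
    have j: "x (G j) \<notin> W" "\<And>r. r < j \<Longrightarrow> x (G r) \<in> W" "j \<le> Suc N"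
    proof -
      from False obtain r where r: "r \<le> Suc N" "x (G r) \<notin> W" by auto
      then show "x (G j) \<notin> W" unfolding j_def by (metis LeastI)
      show "j \<le> Suc N" unfolding j_def using r Least_le[of "\<lambda>r. x (G r) \<notin> W" r] by linarith
      show "x (G r) \<in> W" if "r < j" for r using not_less_Least that unfolding j_def by blast
    qed
    have "j \<noteq> 0"
    proof
      assume "j = 0"
      then show False using j(1) start by (simp add: G_def)
    qed
    then obtain k0 where k0: "j = Suc k0" by (cases j) auto
    have only: "(\<forall>r\<le>k. x (G r) \<in> W) \<and> x (G (Suc k)) \<in> ?T n \<and> ?C k n \<longleftrightarrow>
        k = k0 \<and> x (G (Suc k0)) \<in> ?T n \<and> ?C k0 n" if "n < length s2" for k n
    proof (cases k k0 rule: linorder_cases)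
      case less
      then have "x (G (Suc k)) \<in> W" using j(2) k0 by simp
      then show ?thesis using T_W that less by blast
    next
      case greater
      then have "Suc k0 \<le> k" by simp
      then show ?thesis using j(1) k0 greater by blast
    qed (use j(2) k0 in auto)
    have "(\<Sum>k<Suc N. \<Sum>n<length s2. \<Sum>l\<in>?T n. of_bool (?S k l \<and> ?C k n)) =
        (\<Sum>k<Suc N. \<Sum>n<length s2. of_bool (k = k0 \<and> x (G (Suc k0)) \<in> ?T n \<and> ?C k0 n) :: real)"
      unfolding inner using only by (intro sum.cong refl) auto
    also have "\<dots> = (\<Sum>k<Suc N. if k = k0 then
        (\<Sum>n<length s2. of_bool (x (G (Suc k0)) \<in> ?T n \<and> ?C k0 n) :: real) else 0)"
      by (intro sum.cong) auto
    also have "\<dots> = (\<Sum>n<length s2. of_bool (x (G (Suc k0)) \<in> ?T n \<and> ?C k0 n))"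
      using j(3) k0 by (simp del: sum.lessThan_Suc)
    also have "\<dots> = of_bool (\<exists>n\<in>{..<length s2}. x (G (Suc k0)) \<in> ?T n \<and> ?C k0 n)"
      by (rule sum_of_bool_unique) (use exit_component_unique[OF ne] in auto)
    also have "(\<exists>n\<in>{..<length s2}. x (G (Suc k0)) \<in> ?T n \<and> ?C k0 n) \<longleftrightarrow>
        compatible (A # s1) s2 (t1 # ts) (\<lambda>k. hit x (\<Gamma> k))"
    proof -
      obtain \<sigma> where \<sigma>: "G k0 < \<sigma>" "\<sigma> \<le> G (Suc k0)"
        "\<And>w. G k0 \<le> w \<Longrightarrow> w < \<sigma> \<Longrightarrow> x w = x (G k0)"
        "\<And>w. \<sigma> \<le> w \<Longrightarrow> w \<le> G (Suc k0) \<Longrightarrow> x w = x (G (Suc k0))"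
        using cell[of k0] j(3) k0 by (auto simp: G_def)
      have pos: "0 \<le> G k0" using h by (simp add: G_def)
      have before: "x w \<in> W" if "0 \<le> w" "w < \<sigma>" for w
      proof (cases "w \<le> G k0")
        case True
        show ?thesis
        proof (rule stay_between_grid_points[OF h, of k0])
          show "x (real r * h) \<in> W" if "r \<le> k0" for r
            using j(2)[of r] k0 that by (simp add: G_def)
          show "w \<le> real k0 * h" using True by (simp add: G_def)
        qed (use cell j(3) k0 that(1) in simp_all)
      next
        case False
        then show ?thesis using \<sigma>(3)[of w] that j(2)[of k0] k0 by simp
      qed
      have "G (Suc k0) \<le> t1"
        using j(3) k0 h unfolding t(1)[symmetric] G_def by (intro mult_right_mono) auto
      then have "\<forall>r\<in>set (t1 # ts). G (Suc k0) \<le> r" using t(2) by auto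
      then have "compatible (A # s1) s2 (t1 # ts) (\<lambda>k. hit x (\<Gamma> k)) \<longleftrightarrow>
          (\<exists>n<length s2. x (G (Suc k0)) \<in> ?T n \<and> ?C k0 n)"
      proof (intro compatible_exit[OF rc _ \<sigma>(2)])
        show "0 < \<sigma>" using pos \<sigma>(1) by simp
        show "x w \<notin> hit_states \<Gamma> ((A # s1) @ s2)" if "0 \<le> w" "w < \<sigma>" for w
          using before[OF that] W by blast
        show "x (G (Suc k0)) \<in> hit_states \<Gamma> ((A # s1) @ s2)"
          using j(1) k0 W by blast
      qed (use \<sigma>(4) ne in blast)+
      then show ?thesis by auto
    qed
    finally show ?thesis using False by simp
  qed
qed

lemma borel_measurable_matrix_exp_entry:
  fixes L :: "real^'s^'s::finite"
  shows "(\<lambda>u. matrix_exp (u *\<^sub>R L) $ i $ j) \<in> borel_measurable borel"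
proof -
  have "(\<lambda>u. matrix_exp (u *\<^sub>R L) $ i $ j) = (\<lambda>u. \<Sum>m. u ^ m / fact m * mpow L m $ i $ j)"
    using matrix_exp_entry sums_unique by blast
  moreover have "(\<lambda>u::real. \<Sum>m. u ^ m / fact m * mpow L m $ i $ j) \<in> borel_measurable borel"
    by measurable
  ultimately show ?thesis by simp
qed

section \<open>The process observed on the grid and killed outside a set\<close>

context finite_markov_process
begin

definition grid_survival :: "'s set \<Rightarrow> real \<Rightarrow> nat \<Rightarrow> 's \<Rightarrow> 'w set" where
  "grid_survival W h k j = {\<omega> \<in> space M. (\<forall>r\<le>k. X (real r * h) \<omega> \<in> W) \<and> X (real k * h) \<omega> = j}"

text \<open>The state \<open>l\<close> may also lie in \<open>W\<close>. Then the event is survival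
  for one more step, and \<open>measure_grid_survival\<close> uses it in this way.\<close>

definition grid_exit :: "'s set \<Rightarrow> real \<Rightarrow> nat \<Rightarrow> 's \<Rightarrow> 'w set" where
  "grid_exit W h k l = {\<omega> \<in> space M. (\<forall>r\<le>k. X (real r * h) \<omega> \<in> W) \<and> X (real (Suc k) * h) \<omega> = l}"

text \<open>The matrix \<open>C\<^sub>h\<close>, with zero rows outside \<open>W\<close>, so that \<open>I + h C\<^sub>h\<close> agrees with the transition
  matrix killed outside \<open>W\<close> only in the rows of \<open>W\<close>.\<close>

definition generator_approx :: "'s set \<Rightarrow> real \<Rightarrow> real^'s^'s" where
  "generator_approx W h =
     (\<chi> i j. if i \<in> W \<and> j \<in> W then (transition h i j - of_bool (i = j)) / h else 0)"

lemma grid_stay_in_natural_filtration: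
  assumes "0 \<le> h" "k \<le> n"
  shows "{\<omega> \<in> space M. \<forall>r\<le>k. X (real r * h) \<omega> \<in> W} \<in> sets (natural_filtration M X (real n * h))"
proof -
  have "{\<omega> \<in> space M. \<forall>r\<le>k. X (real r * h) \<omega> \<in> W} = (\<Inter>r\<in>{..k}. {\<omega> \<in> space M. X (real r * h) \<omega> \<in> W})"
    by auto
  also have "\<dots> \<in> sets (natural_filtration M X (real n * h))"
    using assms by (intro sets.finite_INT state_in_natural_filtration) (auto intro!: mult_right_mono)
  finally show ?thesis .
qed

lemma grid_survival_in_natural_filtration:
  assumes "0 \<le> h"
  shows "grid_survival W h k j \<in> sets (natural_filtration M X (real k * h))"
proof -
  have "grid_survival W h k j =
      {\<omega> \<in> space M. \<forall>r\<le>k. X (real r * h) \<omega> \<in> W} \<inter> {\<omega> \<in> space M. X (real k * h) \<omega> \<in> {j}}"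
    by (auto simp: grid_survival_def)
  then show ?thesis
    using assms by (simp only:) (intro sets.Int grid_stay_in_natural_filtration state_in_natural_filtration; simp)
qed

lemma grid_exit_in_natural_filtration:
  assumes "0 \<le> h"
  shows "grid_exit W h k l \<in> sets (natural_filtration M X (real (Suc k) * h))"
proof -
  have "grid_exit W h k l =
      {\<omega> \<in> space M. \<forall>r\<le>k. X (real r * h) \<omega> \<in> W} \<inter> {\<omega> \<in> space M. X (real (Suc k) * h) \<omega> \<in> {l}}"
    by (auto simp: grid_exit_def)
  then show ?thesis
    using assms by (simp only:) (intro sets.Int grid_stay_in_natural_filtration state_in_natural_filtration; simp)
qed

lemma measure_grid_exit:
  assumes "0 \<le> h"
  shows "measure (P i) (grid_exit W h k l) =
    (\<Sum>j\<in>UNIV. measure (P i) (grid_survival W h k j) * transition h j l)"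
proof -
  interpret prob_space "P i" by (rule prob_space_P)
  let ?F = "\<lambda>j. grid_survival W h k j \<inter> {\<omega> \<in> space M. X (real k * h + h) \<omega> = l}"
  have "grid_exit W h k l = (\<Union>j\<in>UNIV. ?F j)"
    by (auto simp: grid_exit_def grid_survival_def algebra_simps)
  also have "prob \<dots> = (\<Sum>j\<in>UNIV. prob (?F j))"
  proof (rule finite_measure_finite_Union)
    show "range ?F \<subseteq> events"
      using grid_survival_in_natural_filtration[OF assms, of W k] natural_filtration_subset
        state_sets[of "real k * h + h" "{l}"] assms
      by (auto simp: sets_P intro!: sets.Int)
    show "disjoint_family ?F"
      by (auto simp: disjoint_family_on_def grid_survival_def)
  qed simp
  also have "\<dots> = (\<Sum>j\<in>UNIV. prob (grid_survival W h k j) * transition h j l)"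
    by (intro sum.cong refl markov_transition grid_survival_in_natural_filtration)
      (use assms in \<open>auto simp: grid_survival_def\<close>)
  finally show ?thesis .
qed

lemma measure_grid_survival_outside: "j \<notin> W \<Longrightarrow> measure (P i) (grid_survival W h k j) = 0"
proof -
  assume "j \<notin> W"
  then have "grid_survival W h k j = {}" by (auto simp: grid_survival_def)
  then show ?thesis by simp
qed

text \<open>One more step in time is one more factor on the right. Rows of this factor outside
  \<open>W\<close> are not those of the killed chain, but they meet survival probabilities in states
  outside \<open>W\<close>, which are 0. At time 0 the formula with \<open>mat 1\<close> relies on
  \<open>i \<in> W\<close>.\<close>

lemma measure_grid_survival:
  assumes "0 < h" "i \<in> W"
  shows "measure (P i) (grid_survival W h k j) = mpow (mat 1 + h *\<^sub>R generator_approx W h) k $ i $ j"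
proof (induction k arbitrary: j)
  case 0
  have "grid_survival W h 0 j \<in> sets M"
    using grid_survival_in_natural_filtration[of h W 0 j] natural_filtration_subset assms by auto
  then have "measure (P i) (grid_survival W h 0 j) =
      measure (P i) ({\<omega> \<in> space M. X 0 \<omega> = i} \<inter> grid_survival W h 0 j)"
    by (rule measure_start_Int[symmetric])
  also have "{\<omega> \<in> space M. X 0 \<omega> = i} \<inter> grid_survival W h 0 j =
      (if i = j then {\<omega> \<in> space M. X 0 \<omega> = i} else {})"
    using assms(2) by (auto simp: grid_survival_def)
  finally show ?case using start[of i] by (cases "i = j") (simp_all add: mat_def)
next
  case (Suc k)
  let ?B = "mat 1 + h *\<^sub>R generator_approx W h"
  have B: "?B $ l $ j = (if l \<in> W \<and> j \<in> W then transition h l j else of_bool (l = j))" for l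
    using assms(1) by (simp add: generator_approx_def mat_def)
  have "mpow ?B (Suc k) $ i $ j = (\<Sum>l\<in>UNIV. measure (P i) (grid_survival W h k l) * ?B $ l $ j)"
    by (simp add: mpow_Suc2 matrix_matrix_mult_def Suc.IH)
  also have "\<dots> = measure (P i) (grid_survival W h (Suc k) j)"
  proof (cases "j \<in> W")
    case True
    then have "grid_survival W h (Suc k) j = grid_exit W h k j"
      by (auto simp: grid_survival_def grid_exit_def le_Suc_eq)
    moreover have "measure (P i) (grid_survival W h k l) * ?B $ l $ j =
        measure (P i) (grid_survival W h k l) * transition h l j" for l
      using True unfolding B by (cases "l \<in> W") (simp_all add: measure_grid_survival_outside)
    ultimately show ?thesis by (simp only: measure_grid_exit[OF less_imp_le[OF assms(1)]])
  next
    case False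
    have "measure (P i) (grid_survival W h k l) * ?B $ l $ j = 0" for l
      using False unfolding B by (cases "l = j") (simp_all add: measure_grid_survival_outside)
    then have "(\<Sum>l\<in>UNIV. measure (P i) (grid_survival W h k l) * ?B $ l $ j) = 0"
      by (intro sum.neutral) blast
    then show ?thesis using measure_grid_survival_outside[OF False] by metis
  qed
  finally show ?case by simp
qed

text \<open>On \<open>W\<close> the entries of \<open>generator_approx\<close> are the difference
  quotients of \<open>intensity\<close>, so \<open>tendsto_mpow_matrix_exp\<close> applies.\<close>

lemma tendsto_grid_survival:
  assumes h: "filterlim h (at_right 0) sequentially" "\<And>N. 0 < h N" and "i \<in> W"
    and \<kappa>: "(\<lambda>N. real (\<kappa> N) * h N) \<longlonglongrightarrow> u"
  shows "(\<lambda>N. measure (P i) (grid_survival W (h N) (\<kappa> N) j)) \<longlonglongrightarrow>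
    matrix_exp (u *\<^sub>R block Q W W) $ i $ j"
proof -
  have "(\<lambda>N. generator_approx W (h N) $ i $ j) \<longlonglongrightarrow> block Q W W $ i $ j" for i j
  proof (cases "i \<in> W \<and> j \<in> W")
    case True
    then show ?thesis
      using filterlim_compose[OF intensity h(1), of i j]
      by (simp add: generator_approx_def block_def transition_def)
  next
    case False
    then have "generator_approx W (h N) $ i $ j = block Q W W $ i $ j" for N
      by (auto simp: generator_approx_def block_def)
    then show ?thesis by simp
  qed
  moreover have "h \<longlonglongrightarrow> 0"
    using h(1) by (simp add: filterlim_at)
  ultimately have "(\<lambda>N. mpow (mat 1 + h N *\<^sub>R generator_approx W (h N)) (\<kappa> N) $ i $ j) \<longlonglongrightarrow>
      matrix_exp (u *\<^sub>R block Q W W) $ i $ j"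
    using h(2) \<kappa> by (intro tendsto_mpow_matrix_exp) (auto intro: less_imp_le)
  then show ?thesis using h(2) \<open>i \<in> W\<close> by (simp add: measure_grid_survival)
qed

lemma mono_measure_hitting_event:
  fixes \<Gamma> :: "'k \<Rightarrow> 's set"
  assumes "\<forall>B\<in>set (s1 @ s2). finite B" "length t = length s1"
  shows "mono (\<lambda>u. measure (P l) (hitting_event M X \<Gamma> s1 s2 (map (\<lambda>r. r - u) t)))"
proof (rule monoI)
  interpret prob_space "P l" by (rule prob_space_P)
  fix u v :: real assume "u \<le> v"
  have "list_all2 (\<lambda>r r'. r' \<le> r) (map (\<lambda>r. r - u) t) (map (\<lambda>r. r - v) t)"
    using \<open>u \<le> v\<close> by (simp add: list_all2_map1 list_all2_map2 list.rel_refl)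
  then have "hitting_event M X \<Gamma> s1 s2 (map (\<lambda>r. r - u) t) \<subseteq> hitting_event M X \<Gamma> s1 s2 (map (\<lambda>r. r - v) t)"
    using assms(2) by (auto simp: hitting_event_eq_compatible intro: compatible_lower_thresholds)
  moreover have "hitting_event M X \<Gamma> s1 s2 (map (\<lambda>r. r - v) t) \<in> events"
    using hitting_event_sets[of s1 s2 "map (\<lambda>r. r - v) t" 0 \<Gamma>] assms by (simp add: sets_P)
  ultimately show "prob (hitting_event M X \<Gamma> s1 s2 (map (\<lambda>r. r - u) t)) \<le>
      prob (hitting_event M X \<Gamma> s1 s2 (map (\<lambda>r. r - v) t))"
    by (rule finite_measure_mono)
qed

lemma remove_component_finite:
  assumes "\<forall>B\<in>set (s1 @ s2). finite B" "n < length s2"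
  shows "\<forall>B\<in>set (s1 @ remove_component n s2). finite B"
  using assms set_remove_component[OF assms(2)] by auto

text \<open>Both conclusions come from the same Riemann sums. The integrability statement serves
  later to split the vector integral of the recursion into these scalar integrals.\<close>

lemma first_exit_decomposition:
  fixes \<Gamma> :: "'k \<Rightarrow> 's set" and A :: "'k set" and s1 s2 :: "'k set list"
    and t1 :: real and ts :: "real list"
  defines "W \<equiv> - hit_states \<Gamma> ((A # s1) @ s2)"
  defines "g \<equiv> \<lambda>n l u. measure (P l) (hitting_event M X \<Gamma> (A # s1) (remove_component n s2)
      (map (\<lambda>r. r - u) (t1 # ts)))"
  assumes fin: "\<forall>B\<in>set ((A # s1) @ s2). finite B" and ne: "{} \<notin> set s2"
    and len: "length ts = length s1" and t1: "0 < t1" and ts: "\<forall>r\<in>set ts. t1 \<le> r" and i: "i \<in> W"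
  shows first_exit_integrable: "\<And>n l j. n < length s2 \<Longrightarrow> l \<in> exit_component \<Gamma> (A # s1) s2 n \<Longrightarrow> j \<in> W \<Longrightarrow>
      set_integrable lborel {0..t1} (\<lambda>u. matrix_exp (u *\<^sub>R block Q W W) $ i $ j * Q $ j $ l * g n l u)"
    and "measure (P i) (hitting_event M X \<Gamma> (A # s1) s2 (t1 # ts)) =
      (\<Sum>n<length s2. \<Sum>l\<in>exit_component \<Gamma> (A # s1) s2 n. \<Sum>j\<in>W.
        LBINT u:{0..t1}. matrix_exp (u *\<^sub>R block Q W W) $ i $ j * Q $ j $ l * g n l u) +
      (\<Sum>j\<in>UNIV. matrix_exp (t1 *\<^sub>R block Q W W) $ i $ j *
        measure (P j) (hitting_event M X \<Gamma> s1 (s2 @ [A]) (map (\<lambda>r. r - t1) ts)))"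
proof -
  interpret prob_space "P i" by (rule prob_space_P)
  let ?T = "exit_component \<Gamma> (A # s1) s2"
  let ?E = "hitting_event M X \<Gamma> (A # s1) s2 (t1 # ts)"
  define h where "h N = t1 / real (Suc N)" for N
  define E1 where "E1 N k n = hitting_event M (\<lambda>r. X (real (Suc k) * h N + r)) \<Gamma> (A # s1)
    (remove_component n s2) (map (\<lambda>r. r - real (Suc k) * h N) (t1 # ts))" for N k n
  define E2 where "E2 = hitting_event M (\<lambda>r. X (t1 + r)) \<Gamma> s1 (s2 @ [A]) (map (\<lambda>r. r - t1) ts)"
  define e where "e j = measure (P j) (hitting_event M X \<Gamma> s1 (s2 @ [A]) (map (\<lambda>r. r - t1) ts))" for j
  define S where "S N k j = measure (P i) (grid_survival W (h N) k j)" for N k j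
  have h: "0 < h N" "real (Suc N) * h N = t1" for N using t1 by (simp_all add: h_def)
  have h_lim: "filterlim h (at_right 0) sequentially"
  proof (rule tendsto_imp_filterlim_at_right)
    show "h \<longlonglongrightarrow> 0" unfolding h_def by (rule LIMSEQ_Suc[OF lim_const_over_n])
  qed (use h in auto)
  have fin1: "\<forall>B\<in>set ((A # s1) @ remove_component n s2). finite B" if "n < length s2" for n
    using fin that by (rule remove_component_finite)
  have fin2: "\<forall>B\<in>set (s1 @ s2 @ [A]). finite B" using fin by auto
  have out: "l \<notin> W" if "l \<in> ?T n" "n < length s2" for l n
    using exit_component_subset_hit_states[OF that(2) ne, of \<Gamma> "A # s1"] that(1) by (auto simp: W_def)
  have E_sets: "?E \<in> events"
    using hitting_event_sets[OF fin, of "t1 # ts" 0 \<Gamma>] len by (simp add: sets_P)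
  have E1_sets: "grid_exit W (h N) k l \<inter> E1 N k n \<in> events" if "n < length s2" for N k l n
    using hitting_event_sets[OF fin1[OF that], of "map (\<lambda>r. r - real (Suc k) * h N) (t1 # ts)"
        "real (Suc k) * h N" \<Gamma>] len h(1)[of N] grid_exit_in_natural_filtration[of "h N" W k l]
      natural_filtration_subset
    by (auto simp: sets_P E1_def intro!: sets.Int)
  have E2_sets: "grid_survival W (h N) (Suc N) j \<inter> E2 \<in> events" for N j
    using hitting_event_sets[OF fin2, of "map (\<lambda>r. r - t1) ts" t1 \<Gamma>] len h(1)[of N] t1
      grid_survival_in_natural_filtration[of "h N" W "Suc N" j] natural_filtration_subset
    by (auto simp: sets_P E2_def intro!: sets.Int)
  have P1: "prob (grid_exit W (h N) k l \<inter> E1 N k n) =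
      (\<Sum>j\<in>W. S N k j * transition (h N) j l * g n l (real (Suc k) * h N))" if "n < length s2" for N k l n
  proof -
    have "prob (grid_exit W (h N) k l \<inter> E1 N k n) =
        prob (grid_exit W (h N) k l) * g n l (real (Suc k) * h N)"
      unfolding E1_def g_def
    proof (rule markov_hitting_event[OF fin1[OF that]])
      show "grid_exit W (h N) k l \<in> sets (natural_filtration M X (real (Suc k) * h N))"
        using h(1)[of N] by (intro grid_exit_in_natural_filtration) simp
      show "0 \<le> real (Suc k) * h N" using h(1)[of N] by simp
      show "X (real (Suc k) * h N) \<omega> = l" if "\<omega> \<in> grid_exit W (h N) k l" for \<omega>
        using that unfolding grid_exit_def by blast
    qed (simp add: len)
    also have "prob (grid_exit W (h N) k l) = (\<Sum>j\<in>W. S N k j * transition (h N) j l)"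
      unfolding measure_grid_exit[OF less_imp_le[OF h(1)]] S_def
      by (rule sum.mono_neutral_right) (auto simp: measure_grid_survival_outside)
    finally show ?thesis by (simp add: sum_distrib_right)
  qed
  have P2: "prob (grid_survival W (h N) (Suc N) j \<inter> E2) = S N (Suc N) j * e j" for N j
    unfolding E2_def e_def S_def
  proof (rule markov_hitting_event[OF fin2])
    show "grid_survival W (h N) (Suc N) j \<in> sets (natural_filtration M X t1)"
      using h(1)[of N] grid_survival_in_natural_filtration[of "h N" W "Suc N" j] h(2)[of N] by simp
    show "0 \<le> t1" using t1 by simp
    show "X t1 \<omega> = j" if "\<omega> \<in> grid_survival W (h N) (Suc N) j" for \<omega>
      using that h(2)[of N] unfolding grid_survival_def by simp
  qed (simp add: len)
  \<comment> \<open>The right-hand side of \<open>compatible_grid\<close> as a random variable. Its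
    expectation factorises by the Markov property at grid points.\<close>
  define Z :: "nat \<Rightarrow> 'w \<Rightarrow> real" where "Z N \<omega> = (\<Sum>k<Suc N. \<Sum>n<length s2. \<Sum>l\<in>?T n.
      indicator (grid_exit W (h N) k l \<inter> E1 N k n) \<omega>) +
      (\<Sum>j\<in>UNIV. indicator (grid_survival W (h N) (Suc N) j \<inter> E2) \<omega>)" for N \<omega>
  \<comment> \<open>The \<delta> below depends on \<omega>, and so does the index from which on the
    equality holds.\<close>
  have Z_eq: "\<forall>\<^sub>F N in sequentially. Z N \<omega> = indicator ?E \<omega>"
    if \<omega>: "\<omega> \<in> space M" "X 0 \<omega> = i" for \<omega>
  proof -
    obtain \<delta> where "0 < \<delta>" and \<delta>: "\<And>a b. 0 \<le> a \<Longrightarrow> a < b \<Longrightarrow> b \<le> t1 \<Longrightarrow> b - a < \<delta> \<Longrightarrow>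
      \<exists>\<sigma>. a < \<sigma> \<and> \<sigma> \<le> b \<and> (\<forall>w. a \<le> w \<and> w < \<sigma> \<longrightarrow> X w \<omega> = X a \<omega>) \<and>
        (\<forall>w. \<sigma> \<le> w \<and> w \<le> b \<longrightarrow> X w \<omega> = X b \<omega>)"
      by (rule single_jump_on_short_intervals[OF right_continuous_path_X[OF \<omega>(1)]
            finitely_many_jumps[OF \<omega>(1), of t1]], rule that)
    have "\<forall>\<^sub>F N in sequentially. h N < \<delta>"
      using h_lim \<open>0 < \<delta>\<close> unfolding filterlim_at by (auto intro: order_tendstoD)
    then show ?thesis
    proof eventually_elim
      case (elim N)
      have cell: "\<exists>\<sigma>. real r * h N < \<sigma> \<and> \<sigma> \<le> real (Suc r) * h N \<and>
        (\<forall>w. real r * h N \<le> w \<and> w < \<sigma> \<longrightarrow> X w \<omega> = X (real r * h N) \<omega>) \<and>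
        (\<forall>w. \<sigma> \<le> w \<and> w \<le> real (Suc r) * h N \<longrightarrow> X w \<omega> = X (real (Suc r) * h N) \<omega>)" if "r < Suc N" for r
      proof (rule \<delta>)
        have "real (Suc r) * h N \<le> real (Suc N) * h N"
          using that h(1)[of N] by (intro mult_right_mono) auto
        then show "real (Suc r) * h N \<le> t1" using h(2) by simp
      qed (use h(1)[of N] elim in \<open>auto simp: algebra_simps\<close>)
      have "indicator ?E \<omega> = (of_bool (compatible (A # s1) s2 (t1 # ts) (\<lambda>k. hit (\<lambda>r. X r \<omega>) (\<Gamma> k))) :: real)"
        using \<omega> len by (simp add: hitting_event_eq_compatible indicator_def)
      also have "\<dots> = (\<Sum>k<Suc N. \<Sum>n<length s2. \<Sum>l\<in>?T n.
         of_bool (((\<forall>r\<le>k. X (real r * h N) \<omega> \<in> W) \<and> X (real (Suc k) * h N) \<omega> = l) \<and>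
         compatible (A # s1) (remove_component n s2) (map (\<lambda>r. r - real (Suc k) * h N) (t1 # ts))
           (\<lambda>i. hit (\<lambda>r. X (real (Suc k) * h N + r) \<omega>) (\<Gamma> i)))) +
         of_bool ((\<forall>r\<le>Suc N. X (real r * h N) \<omega> \<in> W) \<and>
           compatible s1 (s2 @ [A]) (map (\<lambda>r. r - t1) ts) (\<lambda>i. hit (\<lambda>r. X (t1 + r) \<omega>) (\<Gamma> i)))"
        by (rule compatible_grid[OF right_continuous_path_X[OF \<omega>(1)] h(1) cell h(2) ts _ _ ne])
          (use i \<omega> in \<open>auto simp: W_def\<close>)
      also have "\<dots> = Z N \<omega>"
      proof -
        have "of_bool ((\<forall>r\<le>Suc N. X (real r * h N) \<omega> \<in> W) \<and>
           compatible s1 (s2 @ [A]) (map (\<lambda>r. r - t1) ts) (\<lambda>i. hit (\<lambda>r. X (t1 + r) \<omega>) (\<Gamma> i))) =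
           (\<Sum>j\<in>UNIV. indicator (grid_survival W (h N) (Suc N) j \<inter> E2) \<omega> :: real)"
        proof -
          have "(\<Sum>j\<in>UNIV. indicator (grid_survival W (h N) (Suc N) j \<inter> E2) \<omega> :: real) =
              (\<Sum>j\<in>UNIV. of_bool (\<omega> \<in> grid_survival W (h N) (Suc N) j \<inter> E2))"
            by (simp add: indicator_def)
          also have "\<dots> = of_bool (\<exists>j\<in>UNIV. \<omega> \<in> grid_survival W (h N) (Suc N) j \<inter> E2)"
            by (rule sum_of_bool_unique) (auto simp: grid_survival_def)
          also have "(\<exists>j\<in>UNIV. \<omega> \<in> grid_survival W (h N) (Suc N) j \<inter> E2) \<longleftrightarrow>
             ((\<forall>r\<le>Suc N. X (real r * h N) \<omega> \<in> W) \<and>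
             compatible s1 (s2 @ [A]) (map (\<lambda>r. r - t1) ts) (\<lambda>i. hit (\<lambda>r. X (t1 + r) \<omega>) (\<Gamma> i)))"
            using \<omega>(1) len by (simp add: E2_def hitting_event_eq_compatible grid_survival_def)
          finally show ?thesis ..
        qed
        moreover have "indicator (grid_exit W (h N) k l \<inter> E1 N k n) \<omega> =
          (of_bool (((\<forall>r\<le>k. X (real r * h N) \<omega> \<in> W) \<and> X (real (Suc k) * h N) \<omega> = l) \<and>
           compatible (A # s1) (remove_component n s2) (map (\<lambda>r. r - real (Suc k) * h N) (t1 # ts))
           (\<lambda>i. hit (\<lambda>r. X (real (Suc k) * h N + r) \<omega>) (\<Gamma> i))) :: real)" for k n l
          unfolding E1_def using \<omega>(1) len
          by (subst hitting_event_eq_compatible) (simp_all add: grid_exit_def indicator_def del: of_nat_Suc)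
        ultimately show ?thesis unfolding Z_def by (simp only:)
      qed
      finally show ?case ..
    qed
  qed
  \<comment> \<open>Along the grid a path first leaves \<open>W\<close> at one index only, so each
    \<open>n\<close> contributes at most 1 in total, and the survival term at most 1 more.\<close>
  have Z_bound: "norm (Z N \<omega>) \<le> real (length s2) + 1" for N \<omega>
  proof -
    let ?p = "\<lambda>k. (\<forall>r\<le>k. X (real r * h N) \<omega> \<in> W) \<and> X (real (Suc k) * h N) \<omega> \<notin> W"
    have "(\<Sum>l\<in>?T n. indicator (grid_exit W (h N) k l \<inter> E1 N k n) \<omega>) \<le> (of_bool (?p k) :: real)"
      if "n < length s2" for k n
    proof -
      have "(\<Sum>l\<in>?T n. indicator (grid_exit W (h N) k l \<inter> E1 N k n) \<omega> :: real) =
          (\<Sum>l\<in>?T n. of_bool (\<omega> \<in> grid_exit W (h N) k l \<inter> E1 N k n))"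
        by (simp add: indicator_def)
      also have "\<dots> = of_bool (\<exists>l\<in>?T n. \<omega> \<in> grid_exit W (h N) k l \<inter> E1 N k n)"
        by (rule sum_of_bool_unique) (auto simp: grid_exit_def)
      also have "\<dots> \<le> of_bool (?p k)"
        using out that by (auto simp: grid_exit_def)
      finally show ?thesis .
    qed
    then have "(\<Sum>k<Suc N. \<Sum>n<length s2. \<Sum>l\<in>?T n. indicator (grid_exit W (h N) k l \<inter> E1 N k n) \<omega>) \<le>
        (\<Sum>k<Suc N. \<Sum>n<length s2. of_bool (?p k) :: real)"
      by (intro sum_mono) simp
    also have "\<dots> = real (length s2) * (\<Sum>k<Suc N. of_bool (?p k))"
      by (simp only: sum_constant card_lessThan sum_distrib_left)
    also have "(\<Sum>k<Suc N. of_bool (?p k)) = (of_bool (\<exists>k\<in>{..<Suc N}. ?p k) :: real)"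
      by (rule sum_of_bool_unique) (metis Suc_leI finite_lessThan linorder_neqE_nat)+
    also have "real (length s2) * \<dots> \<le> real (length s2)"
      by simp
    finally have 1: "(\<Sum>k<Suc N. \<Sum>n<length s2. \<Sum>l\<in>?T n.
        indicator (grid_exit W (h N) k l \<inter> E1 N k n) \<omega> :: real) \<le> real (length s2)" .
    have "(\<Sum>j\<in>UNIV. indicator (grid_survival W (h N) (Suc N) j \<inter> E2) \<omega> :: real) =
        (\<Sum>j\<in>UNIV. of_bool (\<omega> \<in> grid_survival W (h N) (Suc N) j \<inter> E2))"
      by (simp add: indicator_def)
    also have "\<dots> = of_bool (\<exists>j\<in>UNIV. \<omega> \<in> grid_survival W (h N) (Suc N) j \<inter> E2)"
      by (rule sum_of_bool_unique) (auto simp: grid_survival_def)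
    also have "\<dots> \<le> 1" by simp
    finally have "Z N \<omega> \<le> real (length s2) + 1"
      using 1 unfolding Z_def by (intro add_mono)
    moreover have "0 \<le> Z N \<omega>"
      unfolding Z_def by (intro add_nonneg_nonneg sum_nonneg) auto
    ultimately show ?thesis by simp
  qed
  have Z_meas: "Z N \<in> borel_measurable (P i)" for N
    unfolding Z_def
    by (intro borel_measurable_add borel_measurable_sum borel_measurable_indicator E1_sets E2_sets) simp
  have "AE \<omega> in P i. X 0 \<omega> = i"
    using start[of i] state_sets[of 0 "{i}"] by (subst prob_Collect_eq_1[symmetric]) (simp_all add: space_P sets_P)
  then have "AE \<omega> in P i. (\<lambda>N. Z N \<omega>) \<longlonglongrightarrow> indicator ?E \<omega>"
    using AE_space
  proof eventually_elim
    case (elim \<omega>)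
    then show ?case using Z_eq[of \<omega>] by (intro tendsto_eventually) (simp_all add: space_P)
  qed
  then have "(\<lambda>N. expectation (Z N)) \<longlonglongrightarrow> expectation (indicator ?E)"
    by (intro integral_dominated_convergence[where w = "\<lambda>_. real (length s2) + 1"])
      (use E_sets Z_meas Z_bound in auto)
  then have lim: "(\<lambda>N. expectation (Z N)) \<longlonglongrightarrow> prob ?E"
    using E_sets by simp
  have exp_Z: "expectation (Z N) = (\<Sum>n<length s2. \<Sum>l\<in>?T n. \<Sum>j\<in>W.
      \<Sum>k<Suc N. S N k j * transition (h N) j l * g n l (real (Suc k) * h N)) +
      (\<Sum>j\<in>UNIV. S N (Suc N) j * e j)" for N
  proof -
    have int1: "integrable (P i) (indicator (grid_exit W (h N) k l \<inter> E1 N k n) :: 'w \<Rightarrow> real)"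
      if "n \<in> {..<length s2}" for k l n
      using E1_sets[of n N k l] that by (simp add: emeasure_eq_measure)
    have int2: "integrable (P i) (indicator (grid_survival W (h N) (Suc N) j \<inter> E2) :: 'w \<Rightarrow> real)" for j
      using E2_sets[of N j] by (simp add: emeasure_eq_measure)
    have ev: "expectation (indicator B) = prob B" if "B \<in> events" for B
      using sets.sets_into_space[OF that] by (simp add: Int_absorb2)
    have "expectation (Z N) = (\<Sum>k<Suc N. \<Sum>n<length s2. \<Sum>l\<in>?T n. prob (grid_exit W (h N) k l \<inter> E1 N k n)) +
        (\<Sum>j\<in>UNIV. prob (grid_survival W (h N) (Suc N) j \<inter> E2))"
    proof -
      have "expectation (Z N) =
          expectation (\<lambda>\<omega>. \<Sum>k<Suc N. \<Sum>n<length s2. \<Sum>l\<in>?T n. indicat_real (grid_exit W (h N) k l \<inter> E1 N k n) \<omega>) +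
          expectation (\<lambda>\<omega>. \<Sum>j\<in>UNIV. indicat_real (grid_survival W (h N) (Suc N) j \<inter> E2) \<omega>)"
        unfolding Z_def by (intro Bochner_Integration.integral_add Bochner_Integration.integrable_sum int1 int2)
      also have "expectation (\<lambda>\<omega>. \<Sum>j\<in>UNIV. indicat_real (grid_survival W (h N) (Suc N) j \<inter> E2) \<omega>) =
          (\<Sum>j\<in>UNIV. expectation (indicat_real (grid_survival W (h N) (Suc N) j \<inter> E2)))"
        by (intro Bochner_Integration.integral_sum int2)
      also have "\<dots> = (\<Sum>j\<in>UNIV. prob (grid_survival W (h N) (Suc N) j \<inter> E2))"
        by (intro sum.cong refl ev E2_sets)
      also have "expectation (\<lambda>\<omega>. \<Sum>k<Suc N. \<Sum>n<length s2. \<Sum>l\<in>?T n.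
            indicat_real (grid_exit W (h N) k l \<inter> E1 N k n) \<omega>) =
          (\<Sum>k<Suc N. expectation (\<lambda>\<omega>. \<Sum>n<length s2. \<Sum>l\<in>?T n.
            indicat_real (grid_exit W (h N) k l \<inter> E1 N k n) \<omega>))"
        by (intro Bochner_Integration.integral_sum Bochner_Integration.integrable_sum int1)
      also have "\<dots> = (\<Sum>k<Suc N. \<Sum>n<length s2. expectation (\<lambda>\<omega>. \<Sum>l\<in>?T n.
            indicat_real (grid_exit W (h N) k l \<inter> E1 N k n) \<omega>))"
        by (intro sum.cong refl Bochner_Integration.integral_sum Bochner_Integration.integrable_sum int1)
      also have "\<dots> = (\<Sum>k<Suc N. \<Sum>n<length s2. \<Sum>l\<in>?T n.
            expectation (indicat_real (grid_exit W (h N) k l \<inter> E1 N k n)))"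
        by (intro sum.cong refl Bochner_Integration.integral_sum int1)
      also have "\<dots> = (\<Sum>k<Suc N. \<Sum>n<length s2. \<Sum>l\<in>?T n. prob (grid_exit W (h N) k l \<inter> E1 N k n))"
        by (intro sum.cong refl ev E1_sets) simp
      finally show ?thesis .
    qed
    also have "(\<Sum>j\<in>UNIV. prob (grid_survival W (h N) (Suc N) j \<inter> E2)) = (\<Sum>j\<in>UNIV. S N (Suc N) j * e j)"
      by (simp only: P2)
    also have "(\<Sum>k<Suc N. \<Sum>n<length s2. \<Sum>l\<in>?T n. prob (grid_exit W (h N) k l \<inter> E1 N k n)) =
        (\<Sum>k<Suc N. \<Sum>n<length s2. \<Sum>l\<in>?T n. \<Sum>j\<in>W.
          S N k j * transition (h N) j l * g n l (real (Suc k) * h N))"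
      by (intro sum.cong refl P1) simp
    \<comment> \<open>The sum over time moves inside, so that a Riemann sum is left for each fixed
      \<open>n\<close>, \<open>l\<close> and \<open>j\<close>.\<close>
    also have "\<dots> = (\<Sum>n<length s2. \<Sum>l\<in>?T n. \<Sum>j\<in>W.
        \<Sum>k<Suc N. S N k j * transition (h N) j l * g n l (real (Suc k) * h N))"
      by (subst sum.swap, rule sum.cong[OF refl], subst sum.swap, rule sum.cong[OF refl], rule sum.swap)
    finally show ?thesis .
  qed
  have riemann: "set_integrable lborel {0..t1} (\<lambda>u. matrix_exp (u *\<^sub>R block Q W W) $ i $ j * Q $ j $ l * g n l u) \<and>
      (\<lambda>N. \<Sum>k<Suc N. S N k j * transition (h N) j l * g n l (real (Suc k) * h N)) \<longlonglongrightarrow>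
        (LBINT u:{0..t1}. matrix_exp (u *\<^sub>R block Q W W) $ i $ j * Q $ j $ l * g n l u)"
    if n: "n < length s2" and l: "l \<in> ?T n" and j: "j \<in> W" for n l j
  proof -
    have m: "(\<lambda>N. S N (\<kappa> N) j) \<longlonglongrightarrow> matrix_exp (u *\<^sub>R block Q W W) $ i $ j"
      if "(\<lambda>N. real (\<kappa> N) * (t1 / real (Suc N))) \<longlonglongrightarrow> u" for u \<kappa>
      unfolding S_def using that by (intro tendsto_grid_survival h_lim h(1) i) (simp add: h_def)
    have S_le: "\<bar>S N k j\<bar> \<le> 1" for N k
      unfolding S_def by simp
    \<comment> \<open>Off the diagonal \<open>intensity\<close> speaks of the transition probability
      divided by the time step, with no identity to subtract.\<close>
    have "j \<noteq> l" using out[OF l n] j by auto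
    then have q: "(\<lambda>N. transition (h N) j l / (t1 / real (Suc N))) \<longlonglongrightarrow> Q $ j $ l"
      using filterlim_compose[OF intensity h_lim, of j l] by (simp add: transition_def h_def)
    have g_mono: "mono (g n l)"
      unfolding g_def by (rule mono_measure_hitting_event[OF fin1[OF n]]) (simp add: len)
    have g_le: "\<bar>g n l u\<bar> \<le> 1" for u
      using prob_space.prob_le_1[OF prob_space_P] by (simp add: g_def)
    show ?thesis
      using riemann_sum_limit[OF t1 m S_le q g_mono g_le borel_measurable_matrix_exp_entry]
      by (simp only: h_def)
  qed
  then show "set_integrable lborel {0..t1} (\<lambda>u. matrix_exp (u *\<^sub>R block Q W W) $ i $ j * Q $ j $ l * g n l u)"
    if "n < length s2" "l \<in> ?T n" "j \<in> W" for n l j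
    using that by blast
  have "(\<lambda>N. S N (Suc N) j) \<longlonglongrightarrow> matrix_exp (t1 *\<^sub>R block Q W W) $ i $ j" for j
    unfolding S_def by (intro tendsto_grid_survival h_lim h(1) i) (simp only: h(2) tendsto_const)
  then have "(\<lambda>N. \<Sum>j\<in>UNIV. S N (Suc N) j * e j) \<longlonglongrightarrow>
      (\<Sum>j\<in>UNIV. matrix_exp (t1 *\<^sub>R block Q W W) $ i $ j * e j)"
    by (intro tendsto_sum tendsto_mult_right)
  moreover have "(\<lambda>N. \<Sum>n<length s2. \<Sum>l\<in>?T n. \<Sum>j\<in>W.
      \<Sum>k<Suc N. S N k j * transition (h N) j l * g n l (real (Suc k) * h N)) \<longlonglongrightarrow>
      (\<Sum>n<length s2. \<Sum>l\<in>?T n. \<Sum>j\<in>W.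
        LBINT u:{0..t1}. matrix_exp (u *\<^sub>R block Q W W) $ i $ j * Q $ j $ l * g n l u)"
    by (intro tendsto_sum riemann[THEN conjunct2]) simp_all
  ultimately have "(\<lambda>N. expectation (Z N)) \<longlonglongrightarrow>
      (\<Sum>n<length s2. \<Sum>l\<in>?T n. \<Sum>j\<in>W.
        LBINT u:{0..t1}. matrix_exp (u *\<^sub>R block Q W W) $ i $ j * Q $ j $ l * g n l u) +
      (\<Sum>j\<in>UNIV. matrix_exp (t1 *\<^sub>R block Q W W) $ i $ j * e j)"
    unfolding exp_Z by (rule tendsto_add[rotated])
  with lim show "prob ?E = (\<Sum>n<length s2. \<Sum>l\<in>?T n. \<Sum>j\<in>W.
        LBINT u:{0..t1}. matrix_exp (u *\<^sub>R block Q W W) $ i $ j * Q $ j $ l * g n l u) +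
      (\<Sum>j\<in>UNIV. matrix_exp (t1 *\<^sub>R block Q W W) $ i $ j *
        measure (P j) (hitting_event M X \<Gamma> s1 (s2 @ [A]) (map (\<lambda>r. r - t1) ts)))"
    unfolding e_def by (rule LIMSEQ_unique)
qed

end

section \<open>The recursion\<close>

lemma matrix_exp_zero:
  fixes L :: "real^'s^'s::finite"
  shows "matrix_exp (0 *\<^sub>R L) = mat 1"
proof -
  have "matrix_exp (0 *\<^sub>R L) $ i $ j = mat 1 $ i $ j" for i j
  proof -
    have "(\<lambda>m. 0 ^ m / fact m * mpow L m $ i $ j) = (\<lambda>m. if m = 0 then mpow L 0 $ i $ j else 0)"
      by auto
    then have "(\<lambda>m. 0 ^ m / fact m * mpow L m $ i $ j) sums (mpow L 0 $ i $ j)"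
      using sums_single[of 0 "\<lambda>_. mpow L 0 $ i $ j"] by simp
    from sums_unique2[OF matrix_exp_entry this] show ?thesis by simp
  qed
  then show ?thesis by (simp add: vec_eq_iff)
qed

text \<open>No power of \<lambda>(W) leads from \<open>W\<close> to its complement. The last term of
  the recursion thus uses only the entries of the vector in \<open>W\<close>, for which the
  induction hypothesis is available.\<close>

lemma matrix_exp_block_outside_column:
  assumes "i \<in> W" "j \<notin> W"
  shows "matrix_exp (u *\<^sub>R block Q W W) $ i $ j = 0"
proof -
  have "mpow (block Q W W) m $ i $ j = 0" for m
    using assms by (cases m) (auto simp: mat_def mpow_Suc2 matrix_matrix_mult_def block_def)
  then have "(\<lambda>m. u ^ m / fact m * mpow (block Q W W) m $ i $ j) sums 0"
    by simp
  from sums_unique2[OF matrix_exp_entry this] show ?thesis .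
qed

text \<open>Outside \<open>W\<close> the exponential acts as the identity. Multiplied by a block
  with rows in \<open>W\<close>, these rows vanish, which settles the coordinates of the integrand
  outside \<open>W\<close>.\<close>

lemma matrix_exp_block_outside_row:
  assumes "i \<notin> W" "j \<noteq> i"
  shows "matrix_exp (u *\<^sub>R block Q W W) $ i $ j = 0"
proof -
  have "mpow (block Q W W) m $ i $ j = 0" for m
    using assms by (cases m) (auto simp: mat_def mpow_Suc matrix_matrix_mult_def block_def)
  then have "(\<lambda>m. u ^ m / fact m * mpow (block Q W W) m $ i $ j) sums 0"
    by simp
  from sums_unique2[OF matrix_exp_entry this] show ?thesis .
qed

text \<open>The Bochner integral of a vector function is 0 by convention if a single coordinate
  fails to be integrable. Hence the assumption on all coordinates, even to compute one.\<close>

lemma set_integral_vec_nth: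
  fixes V :: "'a \<Rightarrow> real^'n"
  assumes "\<And>i. set_integrable M A (\<lambda>u. V u $ i)"
  shows "(LINT u:A|M. V u) $ i = (LINT u:A|M. V u $ i)"
proof -
  have "(\<lambda>u. indicator A u *\<^sub>R V u) = (\<lambda>u. \<Sum>i\<in>UNIV. (indicator A u *\<^sub>R V u $ i) *\<^sub>R axis i 1)"
    by (auto simp: fun_eq_iff vec_eq_iff axis_def if_distrib[of "\<lambda>c. _ * c"] cong: if_cong)
  moreover have "integrable M (\<lambda>u. \<Sum>i\<in>UNIV. (indicator A u *\<^sub>R V u $ i) *\<^sub>R (axis i 1 :: real^'n))"
    by (intro Bochner_Integration.integrable_sum integrable_scaleR_left)
      (use assms in \<open>simp_all add: set_integrable_def\<close>)
  ultimately have "integrable M (\<lambda>u. indicator A u *\<^sub>R V u)" by simp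
  from integral_bounded_linear[OF bounded_linear_vec_nth this, of i]
  show ?thesis by (simp add: set_lebesgue_integral_def)
qed

lemma
  fixes f :: "'i \<Rightarrow> 'a \<Rightarrow> real"
  assumes "\<And>i. i \<in> I \<Longrightarrow> set_integrable M A (f i)"
  shows set_integrable_sum: "set_integrable M A (\<lambda>u. \<Sum>i\<in>I. f i u)"
    and set_integral_sum: "(LINT u:A|M. \<Sum>i\<in>I. f i u) = (\<Sum>i\<in>I. LINT u:A|M. f i u)"
  using assms unfolding set_lebesgue_integral_def set_integrable_def scaleR_sum_right
  by (auto intro!: Bochner_Integration.integral_sum)

text \<open>The block confines \<open>j\<close> to \<open>W\<close> and \<open>restricted_id\<close>
  confines \<open>l\<close> to \<open>T n\<close>; since \<open>T n \<subseteq> U\<close>, the block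
  cuts off none of these \<open>l\<close>.\<close>

lemma exit_integrand_component:
  fixes E :: "real^'s^'s::finite" and p :: "nat \<Rightarrow> real^'s"
  assumes "\<And>n. n < N \<Longrightarrow> T n \<subseteq> U"
  shows "((E ** block Q W U) *v (\<Sum>n<N. restricted_id (T n) *v p n)) $ i =
    (\<Sum>n<N. \<Sum>l\<in>T n. \<Sum>j\<in>W. E $ i $ j * Q $ j $ l * p n $ l)"
proof -
  have row: "(E ** block Q W U) $ i $ l = (\<Sum>j\<in>W. E $ i $ j * Q $ j $ l)" if "l \<in> U" for l
  proof -
    have "(E ** block Q W U) $ i $ l = (\<Sum>j\<in>UNIV. if j \<in> W then E $ i $ j * Q $ j $ l else 0)"
      using that by (auto simp: matrix_matrix_mult_def block_def intro!: sum.cong)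
    then show ?thesis by (simp add: sum.If_cases)
  qed
  have "(E ** block Q W U) *v (\<Sum>n<N. restricted_id (T n) *v p n) =
      (\<Sum>n<N. (E ** block Q W U) *v (restricted_id (T n) *v p n))"
    by (rule linear_sum[OF matrix_vector_mul_linear])
  then have "((E ** block Q W U) *v (\<Sum>n<N. restricted_id (T n) *v p n)) $ i =
      (\<Sum>n<N. ((E ** block Q W U) *v (restricted_id (T n) *v p n)) $ i)"
    by simp
  also have "\<dots> = (\<Sum>n<N. \<Sum>l\<in>T n. \<Sum>j\<in>W. E $ i $ j * Q $ j $ l * p n $ l)"
  proof (rule sum.cong[OF refl])
    fix n assume "n \<in> {..<N}"
    then have T: "T n \<subseteq> U" using assms by simp
    have "(restricted_id (T n) *v p n) $ l = (if l \<in> T n then p n $ l else 0)" for l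
      by (simp add: restricted_id_def matrix_vector_mult_def if_distrib[of "\<lambda>c. c * _"] cong: if_cong)
    then have "((E ** block Q W U) *v (restricted_id (T n) *v p n)) $ i =
        (\<Sum>l\<in>UNIV. if l \<in> T n then (E ** block Q W U) $ i $ l * p n $ l else 0)"
      by (auto simp: matrix_vector_mult_def intro!: sum.cong)
    also have "\<dots> = (\<Sum>l\<in>T n. (E ** block Q W U) $ i $ l * p n $ l)"
      by (simp add: sum.If_cases)
    also have "\<dots> = (\<Sum>l\<in>T n. \<Sum>j\<in>W. E $ i $ j * Q $ j $ l * p n $ l)"
      using T by (intro sum.cong refl) (simp add: row subsetD sum_distrib_right)
    finally show "((E ** block Q W U) *v (restricted_id (T n) *v p n)) $ i =
        (\<Sum>l\<in>T n. \<Sum>j\<in>W. E $ i $ j * Q $ j $ l * p n $ l)" .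
  qed
  finally show ?thesis .
qed

context finite_markov_process
begin

text \<open>From a state outside all targets every relevant hitting time is positive, so a threshold
  0 is passed at once: this is \<open>compatible_no_exit\<close> with \<open>b\<close> equal to
  0.\<close>

lemma measure_hitting_event_zero_threshold:
  fixes \<Gamma> :: "'k \<Rightarrow> 's set"
  assumes fin: "\<forall>B\<in>set ((A # s1) @ s2). finite B" and len: "length ts = length s1"
    and i: "i \<notin> hit_states \<Gamma> ((A # s1) @ s2)"
  shows "measure (P i) (hitting_event M X \<Gamma> (A # s1) s2 (0 # ts)) =
    measure (P i) (hitting_event M X \<Gamma> s1 (s2 @ [A]) ts)"
proof -
  have fin': "\<forall>B\<in>set (s1 @ s2 @ [A]). finite B" using fin by auto
  have sets: "hitting_event M X \<Gamma> (A # s1) s2 (0 # ts) \<in> sets M"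
    "hitting_event M X \<Gamma> s1 (s2 @ [A]) ts \<in> sets M"
    using hitting_event_sets[OF fin, of "0 # ts" 0 \<Gamma>] hitting_event_sets[OF fin', of ts 0 \<Gamma>] len by simp_all
  have "compatible (A # s1) s2 (0 # ts) (\<lambda>k. hit (\<lambda>r. X r \<omega>) (\<Gamma> k)) \<longleftrightarrow>
      compatible s1 (s2 @ [A]) ts (\<lambda>k. hit (\<lambda>r. X r \<omega>) (\<Gamma> k))"
    if "\<omega> \<in> space M" "X 0 \<omega> = i" for \<omega>
    using compatible_no_exit[OF right_continuous_path_X[OF that(1)], of 0 \<Gamma> A s1 s2 ts] that(2) i
    by simp
  then have "{\<omega> \<in> space M. X 0 \<omega> = i} \<inter> hitting_event M X \<Gamma> (A # s1) s2 (0 # ts) =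
      {\<omega> \<in> space M. X 0 \<omega> = i} \<inter> hitting_event M X \<Gamma> s1 (s2 @ [A]) ts"
    using len by (auto simp: hitting_event_eq_compatible)
  then show ?thesis
    using measure_start_Int[OF sets(1), of i] measure_start_Int[OF sets(2), of i] by simp
qed

text \<open>Nested induction along the termination order of \<open>prob_vector\<close>: outside on
  \<open>s1\<close>, inside on the number of components of \<open>s2\<close>. The condition on
  \<open>i\<close> is inherited by states of T_n, which avoid the targets of the other components by
  definition, and by states of W when \<open>A\<close> changes sides, since the union of the targets
  stays the same.\<close>

lemma measure_hitting_event_eq_prob_vector:
  fixes \<Gamma> :: "'k \<Rightarrow> 's set"
  assumes "\<forall>B\<in>set (s1 @ s2). finite B" "{} \<notin> set (s1 @ s2)" "length t = length s1"
    "\<forall>r\<in>set t. 0 \<le> r" "sorted_wrt (<) t" "i \<notin> hit_states \<Gamma> (s1 @ s2)"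
  shows "measure (P i) (hitting_event M X \<Gamma> s1 s2 t) = prob_vector M P X Q \<Gamma> s1 s2 t $ i"
  using assms
proof (induction s1 arbitrary: s2 t i)
  case Nil
  then show ?case by simp
next
  case (Cons A s1)
  note IH1 = Cons.IH
  note [simp del] = prob_vector.simps(2) \<comment> \<open>loops as a rewrite rule\<close>
  from Cons.prems show ?case
  proof (induction "length s2" arbitrary: s2 t i rule: less_induct)
    case less
    note IH2 = less.hyps and fin = less.prems(1) and ne = less.prems(2) and i = less.prems(6)
    obtain t1 ts where t: "t = t1 # ts" and len: "length ts = length s1"
      using less.prems(3) by (cases t) auto
    have t1: "0 \<le> t1" and ts: "\<forall>r\<in>set ts. t1 < r" "sorted_wrt (<) ts"
      using less.prems(4,5) by (auto simp: t)
    define W where "W = - hit_states \<Gamma> ((A # s1) @ s2)"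
    define T where "T = exit_component \<Gamma> (A # s1) s2"
    let ?U = "exit_states \<Gamma> (A # s1) s2"
    let ?E = "\<lambda>u. matrix_exp (u *\<^sub>R block Q W W)"
    define p where "p n u = prob_vector M P X Q \<Gamma> (A # s1) (remove_component n s2) (map (\<lambda>r. r - u) t)" for n u
    define g where "g n l u = measure (P l) (hitting_event M X \<Gamma> (A # s1) (remove_component n s2)
      (map (\<lambda>r. r - u) (t1 # ts)))" for n l u
    define q where "q = prob_vector M P X Q \<Gamma> s1 (s2 @ [A]) (map (\<lambda>r. r - t1) ts)"
    define e where "e j = measure (P j) (hitting_event M X \<Gamma> s1 (s2 @ [A]) (map (\<lambda>r. r - t1) ts))" for j
    define V where "V = (\<lambda>u. (?E u ** block Q W ?U) *v (\<Sum>n<length s2. restricted_id (T n) *v p n u))"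
    have pv: "prob_vector M P X Q \<Gamma> (A # s1) s2 t = (LBINT u:{0..t1}. V u) + ?E t1 *v q"
      unfolding t by (subst prob_vector.simps(2))
        (simp only: V_def T_def p_def q_def W_def t Let_def list.sel)
    have "i \<in> W" using i by (simp add: W_def)
    \<comment> \<open>The ordering of \<open>t\<close> keeps the thresholds r - t1
      nonnegative.\<close>
    have e: "e j = q $ j" if "j \<in> W" for j
      unfolding e_def q_def
    proof (rule IH1)
      show "sorted_wrt (<) (map (\<lambda>r. r - t1) ts)"
        using ts(2) by (simp add: sorted_wrt_map)
      show "j \<notin> hit_states \<Gamma> (s1 @ s2 @ [A])"
        using that by (auto simp: W_def hit_states_Union)
    qed (use fin ne ts(1) len in \<open>auto intro: less_imp_le\<close>)
    \<comment> \<open>Confined to u \<le> t1: beyond it the first threshold would be negative and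
      the induction hypothesis would not apply.\<close>
    have g: "p n u $ l = g n l u" if "n < length s2" "l \<in> T n" "u \<in> {0..t1}" for n l u
      unfolding g_def p_def t[symmetric]
    proof (rule IH2[symmetric])
      show "length (remove_component n s2) < length s2"
        using that(1) by (simp add: remove_component_def)
      show "\<forall>B\<in>set ((A # s1) @ remove_component n s2). finite B"
        using fin that(1) by (rule remove_component_finite)
      show "{} \<notin> set ((A # s1) @ remove_component n s2)"
        using ne set_remove_component[OF that(1)] by auto
      show "\<forall>r\<in>set (map (\<lambda>r. r - u) t). 0 \<le> r"
        using that(3) ts(1) by (force simp: t)
      show "sorted_wrt (<) (map (\<lambda>r. r - u) t)"
        using less.prems(5) by (simp add: sorted_wrt_map)
      show "l \<notin> hit_states \<Gamma> ((A # s1) @ remove_component n s2)"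
        using that(2) by (simp add: T_def exit_component_def)
    qed (use less.prems(3) in simp)
    have V_nth: "V u $ i' = (\<Sum>n<length s2. \<Sum>l\<in>T n. \<Sum>j\<in>W. ?E u $ i' $ j * Q $ j $ l * p n u $ l)" for u i'
      unfolding V_def
      by (rule exit_integrand_component) (auto simp: T_def exit_states_def)
    have q_sum: "(?E t1 *v q) $ i = (\<Sum>j\<in>UNIV. ?E t1 $ i $ j * e j)"
    proof -
      have "?E t1 $ i $ j * q $ j = ?E t1 $ i $ j * e j" for j
        using e[of j] matrix_exp_block_outside_column[OF \<open>i \<in> W\<close>, of j] by (cases "j \<in> W") auto
      then show ?thesis
        unfolding matrix_vector_mult_def vec_lambda_beta by (intro sum.cong refl)
    qed
    show ?case
    proof (cases "t1 = 0")
      \<comment> \<open>The mesh would be 0. Here the integral runs over a single point and the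
        exponential is the identity.\<close>
      case True
      have "(LBINT u:{0..t1}. V u) = 0"
        unfolding set_lebesgue_integral_def
      proof (rule integral_eq_zero_AE)
        show "AE u in lborel. indicator {0..t1} u *\<^sub>R V u = 0"
          using AE_lborel_singleton[of 0] by eventually_elim (auto simp: True)
      qed
      moreover have "(?E t1 *v q) $ i = e i"
        using e[OF \<open>i \<in> W\<close>] by (simp only: True matrix_exp_zero matrix_vector_mul_lid)
      moreover have "measure (P i) (hitting_event M X \<Gamma> (A # s1) s2 t) = e i"
        using measure_hitting_event_zero_threshold[OF fin len i] by (simp add: e_def t True)
      ultimately show ?thesis by (simp add: pv)
    next
      case False
      with t1 have "0 < t1" by simp
      have ne2: "{} \<notin> set s2" using ne by simp
      have ts': "\<forall>r\<in>set ts. t1 \<le> r" using ts(1) by auto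
      have int: "set_integrable lborel {0..t1} (\<lambda>u. ?E u $ i' $ j * Q $ j $ l * g n l u)"
        if "n < length s2" "l \<in> T n" "j \<in> W" "i' \<in> W" for n l j i'
        unfolding g_def W_def T_def
        by (rule first_exit_integrable[OF fin ne2 len \<open>0 < t1\<close> ts']) (use that in \<open>simp_all add: W_def T_def\<close>)
      \<comment> \<open>The indicator is kept because the two integrands are known to agree only on
        [0, t1].\<close>
      have V_eq: "indicator {0..t1} u *\<^sub>R V u $ i' = indicator {0..t1} u *\<^sub>R
          (\<Sum>n<length s2. \<Sum>l\<in>T n. \<Sum>j\<in>W. ?E u $ i' $ j * Q $ j $ l * g n l u)" for u i'
      proof (cases "u \<in> {0..t1}")
        case True
        then show ?thesis
          unfolding V_nth by (intro arg_cong[of _ _ "scaleR _"] sum.cong refl) (simp add: g)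
      qed simp
      \<comment> \<open>Every coordinate i' is covered, as \<open>set_integral_vec_nth\<close>
        demands. Outside \<open>W\<close> the coordinate is identically 0.\<close>
      have V_int: "set_integrable lborel {0..t1} (\<lambda>u. V u $ i')" for i'
      proof (cases "i' \<in> W")
        case True
        have "set_integrable lborel {0..t1}
            (\<lambda>u. \<Sum>n<length s2. \<Sum>l\<in>T n. \<Sum>j\<in>W. ?E u $ i' $ j * Q $ j $ l * g n l u)"
          using True by (intro set_integrable_sum int) auto
        then show ?thesis unfolding set_integrable_def V_eq .
      next
        case False
        have "?E u $ i' $ j = 0" if "j \<in> W" for u j
          using False that by (intro matrix_exp_block_outside_row) auto
        then have "V u $ i' = 0" for u
          unfolding V_nth by simp
        then show ?thesis by (simp add: set_integrable_def)
      qed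
      have "(LBINT u:{0..t1}. V u) $ i = (LBINT u:{0..t1}. V u $ i)"
        by (rule set_integral_vec_nth) (rule V_int)
      also have "\<dots> = (LBINT u:{0..t1}. \<Sum>n<length s2. \<Sum>l\<in>T n. \<Sum>j\<in>W. ?E u $ i $ j * Q $ j $ l * g n l u)"
        unfolding set_lebesgue_integral_def V_eq ..
      also have "\<dots> = (\<Sum>n<length s2. \<Sum>l\<in>T n. \<Sum>j\<in>W. LBINT u:{0..t1}. ?E u $ i $ j * Q $ j $ l * g n l u)"
      proof -
        have int': "set_integrable lborel {0..t1} (\<lambda>u. ?E u $ i $ j * Q $ j $ l * g n l u)"
          if "n \<in> {..<length s2}" "l \<in> T n" "j \<in> W" for n l j
          using int that \<open>i \<in> W\<close> by simp
        have "(LBINT u:{0..t1}. \<Sum>n<length s2. \<Sum>l\<in>T n. \<Sum>j\<in>W. ?E u $ i $ j * Q $ j $ l * g n l u) =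
            (\<Sum>n<length s2. LBINT u:{0..t1}. \<Sum>l\<in>T n. \<Sum>j\<in>W. ?E u $ i $ j * Q $ j $ l * g n l u)"
          by (intro set_integral_sum set_integrable_sum int')
        also have "\<dots> = (\<Sum>n<length s2. \<Sum>l\<in>T n. LBINT u:{0..t1}. \<Sum>j\<in>W. ?E u $ i $ j * Q $ j $ l * g n l u)"
          by (intro sum.cong[OF refl] set_integral_sum set_integrable_sum int')
        also have "\<dots> = (\<Sum>n<length s2. \<Sum>l\<in>T n. \<Sum>j\<in>W. LBINT u:{0..t1}. ?E u $ i $ j * Q $ j $ l * g n l u)"
          by (intro sum.cong[OF refl] set_integral_sum int')
        finally show ?thesis .
      qed
      finally have "prob_vector M P X Q \<Gamma> (A # s1) s2 t $ i =
          (\<Sum>n<length s2. \<Sum>l\<in>T n. \<Sum>j\<in>W. LBINT u:{0..t1}. ?E u $ i $ j * Q $ j $ l * g n l u) +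
          (\<Sum>j\<in>UNIV. ?E t1 $ i $ j * e j)"
        by (simp only: pv vector_add_component q_sum)
      also have "\<dots> = measure (P i) (hitting_event M X \<Gamma> (A # s1) s2 t)"
        unfolding g_def e_def W_def T_def t
        by (rule first_exit_decomposition(2)[OF fin ne2 len \<open>0 < t1\<close> ts', symmetric]) (use i in simp)
      finally show ?thesis ..
    qed
  qed
qed

end

text \<open>\<open>measure_of\<close> returns the given set function once countable additivity is
  established; it passes from the \<open>P i\<close> to a finite combination with nonnegative
  weights.\<close>

lemma measure_mixture:
  fixes P :: "'s::finite \<Rightarrow> 'w measure"
  assumes sets_P: "\<And>i. sets (P i) = sets M" and prob: "\<And>i. prob_space (P i)"
    and \<alpha>: "\<forall>i. 0 \<le> \<alpha> $ i" and E: "E \<in> sets M"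
  shows "measure (mixture M P \<alpha>) E = (\<Sum>i\<in>UNIV. \<alpha> $ i * measure (P i) E)"
proof -
  let ?\<mu> = "\<lambda>A. \<Sum>i\<in>UNIV. ennreal (\<alpha> $ i) * emeasure (P i) A"
  have "emeasure (mixture M P \<alpha>) E = ?\<mu> E"
  proof (rule emeasure_measure_of)
    show "mixture M P \<alpha> = measure_of (space M) (sets M) ?\<mu>" by (simp add: mixture_def)
    show "positive (sets (mixture M P \<alpha>)) ?\<mu>" by (simp add: positive_def)
    show "countably_additive (sets (mixture M P \<alpha>)) ?\<mu>"
    proof (rule countably_additiveI)
      fix B :: "nat \<Rightarrow> 'w set"
      assume "range B \<subseteq> sets (mixture M P \<alpha>)" and disj: "disjoint_family B"
      then have "range B \<subseteq> sets (P i)" for i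
        by (simp add: mixture_def sets_P)
      then have "(\<Sum>n. ennreal (\<alpha> $ i) * emeasure (P i) (B n)) = ennreal (\<alpha> $ i) * emeasure (P i) (\<Union>n. B n)" for i
        using disj by (simp add: suminf_emeasure)
      then show "(\<Sum>n. ?\<mu> (B n)) = ?\<mu> (\<Union>n. B n)"
        by (subst suminf_sum) auto
    qed
  qed (use E sets.space_closed in \<open>auto simp: mixture_def\<close>)
  also have "\<dots> = ennreal (\<Sum>i\<in>UNIV. \<alpha> $ i * measure (P i) E)"
    using \<alpha> prob by (simp add: finite_measure.emeasure_eq_measure prob_space.finite_measure
        ennreal_mult sum_ennreal[symmetric] del: sum_ennreal)
  finally show ?thesis
    using \<alpha> by (simp add: measure_def sum_nonneg)
qed

theorem theorem3p3:
  fixes M :: "'w measure"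
    and P :: "'s::finite \<Rightarrow> 'w measure"
    and X :: "real \<Rightarrow> 'w \<Rightarrow> 's"
    and Q :: "real^'s^'s"
    and K :: "'k set"
    and \<Gamma> :: "'k \<Rightarrow> 's set"
    and s1 s2 :: "'k set list"
    and t :: "real list"
    and \<alpha> :: "real^'s"
  assumes "finite_markov_process M P X Q"
    and "finite K"
    and "subpartition K s1"
    and "subpartition K s2"
    and "\<Union>(set s1) \<inter> \<Union>(set s2) = {}"
    and "length t = length s1"
    and "\<forall>r\<in>set t. 0 \<le> r"
    and "sorted_wrt (<) t"
    and "- hit_states \<Gamma> (s1 @ s2) \<noteq> {}"
    and "\<forall>i. 0 \<le> \<alpha> $ i"
    and "(\<Sum>i\<in>UNIV. \<alpha> $ i) = 1"
    and "\<forall>i. i \<notin> - hit_states \<Gamma> (s1 @ s2) \<longrightarrow> \<alpha> $ i = 0"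
  shows "measure (mixture M P \<alpha>) (hitting_event M X \<Gamma> s1 s2 t)
         = \<alpha> \<bullet> prob_vector M P X Q \<Gamma> s1 s2 t"
proof -
  interpret finite_markov_process M P X Q by fact
  have fin: "\<forall>B\<in>set (s1 @ s2). finite B" and ne: "{} \<notin> set (s1 @ s2)"
    using assms(2-4) finite_subset by (auto simp: subpartition_def)
  have "hitting_event M X \<Gamma> s1 s2 t \<in> sets M"
    using hitting_event_sets[OF fin assms(6), of 0 \<Gamma>] by simp
  then have "measure (mixture M P \<alpha>) (hitting_event M X \<Gamma> s1 s2 t) =
      (\<Sum>i\<in>UNIV. \<alpha> $ i * measure (P i) (hitting_event M X \<Gamma> s1 s2 t))"
    by (rule measure_mixture[OF sets_P prob_space_P assms(10)])
  also have "\<dots> = (\<Sum>i\<in>UNIV. \<alpha> $ i * prob_vector M P X Q \<Gamma> s1 s2 t $ i)"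
  proof (rule sum.cong[OF refl])
    fix i
    show "\<alpha> $ i * measure (P i) (hitting_event M X \<Gamma> s1 s2 t) = \<alpha> $ i * prob_vector M P X Q \<Gamma> s1 s2 t $ i"
    proof (cases "i \<in> hit_states \<Gamma> (s1 @ s2)")
      case True
      then show ?thesis using assms(12) by simp
    next
      case False
      then show ?thesis
        using measure_hitting_event_eq_prob_vector[OF fin ne assms(6-8), of i \<Gamma>] by simp
    qed
  qed
  finally show ?thesis by (simp add: inner_vec_def)
qed

end
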